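(* Let $\mathcal{I}\in\mathrm{Subsets}(r,n,s)$ be such that $\mathrm{edim}\,\mathcal{I}=0$, and let $\delta_{\mathcal{I}}\colon\mathrm{GL}(r)^s\times\mathrm{GL}(n-r)^s\to\mathbb{C}$ be the corresponding determinant function. Then $\delta_{\mathcal{I}}$ belongs to $$\bigotimes_{k=1}^s\bigl(L_{BW}(\lambda_{I_k}^* )\otimes L_{BW}(\lambda_{I_k^c}^*-r\mathbb{1}_{n-r})\bigr).$$ Moreover, $\delta_{\mathcal{I}}$ transforms under the diagonal action of $\mathrm{GL}(r)\times\mathrm{GL}(n-r)$ by the character $\det_r^{(n-r)(s-1)}\otimes\det_{n-r}^{r(1-s)}$, i.e. $(g,g')\cdot\delta_{\mathcal{I}}=\det(g)^{(n-r)(s-1)}\det(g')^{r(1-s)}\,\delta_{\mathcal{I}}$ for all $g\in\mathrm{GL}(r)$, $g'\in\mathrm{GL}(n-r)$.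
   Context: Write $[n]=\{1,\dots,n\}$, $r\in[n]$. A subset $I\subseteq[n]$ of cardinality $r$ is identified with its increasing sequence $I(1)<\dots<I(r)$; $I^c=[n]\setminus I$. $\mathrm{Subsets}(r,n,s)$ is the set of $s$-tuples $\mathcal{I}=(I_1,\dots,I_s)$ of subsets of $[n]$ of cardinality $r$. Put $\dim I=\sum_{a=1}^r(I(a)-a)$ and $\mathrm{edim}\,\mathcal{I}=r(n-r)-\sum_{k=1}^s(r(n-r)-\dim I_k)$. Let $V_0=\mathbb{C}^r$ and $Q_0=\mathbb{C}^{n-r}$ with standard bases $e(1),\dots,e(r)$ and $\bar e(1),\dots,\bar e(n-r)$, and standard flags $F_0(a)=\mathrm{span}\{e(1),\dots,e(a)\}$, $G_0(b)=\mathrm{span}\{\bar e(1),\dots,\bar e(b)\}$. For $I\subseteq[n]$ of cardinality $r$, $H_I(F_0,G_0)=\{\phi\in\mathrm{Hom}(V_0,Q_0):\phi(F_0(a))\subseteq G_0(I(a)-a)\ \forall a\in[r]\}$, a space of dimension $\dim I$. For $\vec g\in\mathrm{GL}(r)^s$, $\vec h\in\mathrm{GL}(n-r)^s$ define the linear map $$\Delta_{\mathcal{I},\vec g,\vec h}\colon\mathrm{Hom}(V_0,Q_0)\times H_{I_1}(F_0,G_0)\times\dots\times H_{I_s}(F_0,G_0)\to\mathrm{Hom}(V_0,Q_0)^s,$$ $(\zeta,\phi_1,\dots,\phi_s)\mapsto(\zeta+h_1\phi_1g_1^{-1},\dots,\zeta+h_s\phi_sg_s^{-1})$. If $\mathrm{edim}\,\mathcal{I}=0$,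 domain and target have equal dimension, and the determinant function is $\delta_{\mathcal{I}}(\vec g,\vec h)=\det\Delta_{\mathcal{I},\vec g,\vec h}$, where the determinant is taken with respect to two arbitrary fixed bases (of domain and target) not depending on $\vec g,\vec h$. $B(r)\subseteq\mathrm{GL}(r)$ is the group of invertible upper-triangular matrices. For $\mu\in\mathbb{Z}^r$, $\chi_\mu$ is the character of $B(r)$ with $\chi_\mu(t)=t(1)^{\mu(1)}\cdots t(r)^{\mu(r)}$ for diagonal $t=\mathrm{diag}(t(1),\dots,t(r))$. For a dominant weight $\lambda$ (i.e. $\lambda\in\mathbb{Z}^r$, $\lambda(1)\geq\dots\geq\lambda(r)$) put $\lambda^*=(-\lambda(r),\dots,-\lambda(1))$. The Borel–Weil realization of the irreducible representation of highest weight $\lambda$ is $L_{BW}(\lambda)=\{s\colon\mathrm{GL}(r)\to\mathbb{C}\text{ holomorphic}: s(gb)=s(g)\chi_{\lambda^*}(b)\ \forall g\in\mathrm{GL}(r),b\in B(r)\}$ with action $(g\cdot s)(h)=s(g^{-1}h)$. Tensor products of such spaces (for possibly different groups $\mathrm{GL}(r)$, $\mathrm{GL}(n-r)$) are identified with the spaces of holomorphic functions on the product group with the corresponding equivariance in each argument. The diagonal action is $((g,g')\cdot\delta)(\vec g,\vec h)=\delta(g^{-1}\vec g,g'^{-1}\vec h)$, where $g^{-1}\vec g=(g^{-1}g_1,\dots,g^{-1}g_s)$, and similarly for $\vec h$. For $I\subseteq[n]$ of cardinality $r$: $\lambda_I(a)=a-I(a)$, $a\in[r]$ (a dominant weight of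 $\mathrm{GL}(r)$), and $\lambda_{I^c}(b)=b-I^c(b)$, $b\in[n-r]$ (a dominant weight of $\mathrm{GL}(n-r)$). $\mathbb{1}_m=(1,\dots,1)\in\mathbb{Z}^m$, and $\det_m$ is the determinant character of $\mathrm{GL}(m)$. *)

theory Defs
  imports
    Complex_Main
    "Jordan_Normal_Form.Gauss_Jordan_Elimination"
    "Jordan_Normal_Form.VS_Connect"
begin

section \<open>Subsets of $\{1,\dots,n\}$ and expected dimension\<close>

definition Subsets :: "nat \<Rightarrow> nat \<Rightarrow> nat \<Rightarrow> nat set list set" where
  "Subsets r n s = {Is. length Is = s \<and> (\<forall>I \<in> set Is. I \<subseteq> {1..n} \<and> card I = r)}"

text \<open>\<open>elt I a\<close> is the \<open>a\<close>-th smallest element \<open>I(a)\<close>, for \<open>a = 1, \<dots>, card I\<close>.\<close>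

definition elt :: "nat set \<Rightarrow> nat \<Rightarrow> nat" where
  "elt I a = sorted_list_of_set I ! (a - 1)"

definition dim_set :: "nat set \<Rightarrow> int" where
  "dim_set I = (\<Sum>a = 1..card I. int (elt I a) - int a)"

definition edim :: "nat \<Rightarrow> nat \<Rightarrow> nat set list \<Rightarrow> int" where
  "edim n r Is = int (r * (n - r)) -
     (\<Sum>k<length Is. int (r * (n - r)) - dim_set (Is ! k))"

section \<open>Matrix groups\<close>

definition GL :: "nat \<Rightarrow> complex mat set" where
  "GL m = {g \<in> carrier_mat m m. invertible_mat g}"

definition borel_GL :: "nat \<Rightarrow> complex mat set" where
  "borel_GL m = {b \<in> GL m. upper_triangular b}"

definition inv_mat :: "complex mat \<Rightarrow> complex mat" where
  "inv_mat g = the (mat_inverse g)"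

section \<open>Flags, tuples of homomorphisms, and the determinant function\<close>

definition std_flag :: "nat \<Rightarrow> nat \<Rightarrow> complex vec set" where
  "std_flag m a =
     LinearCombinations.module.span class_ring (module_vec TYPE(complex) m) (unit_vec m ` {..<a})"

text \<open>A linear map from \<open>V\<^sub>0 = \<complex>\<^sup>r\<close> to \<open>Q\<^sub>0 = \<complex>\<^sup>n\<^sup>-\<^sup>r\<close> is given by its \<open>(n - r) \<times> r\<close> matrix.\<close>

definition Hom_flag :: "nat \<Rightarrow> nat \<Rightarrow> nat set \<Rightarrow> complex mat set" where
  "Hom_flag n r I = {\<phi> \<in> carrier_mat (n - r) r.
     \<forall>a \<in> {1..r}. (\<lambda>v. \<phi> *\<^sub>v v) ` std_flag r a \<subseteq> std_flag (n - r) (elt I a - a)}"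

text \<open>For a list \<open>Ss\<close> of subspaces of the space of \<open>p \<times> q\<close> matrices,
  \<open>mat_tuples p q Ss\<close> is their direct product, with componentwise operations. The ring fields
  \<open>mult\<close> and \<open>one\<close> of the record play no role in a vector space.\<close>

definition mat_tuples ::
    "nat \<Rightarrow> nat \<Rightarrow> complex mat set list \<Rightarrow> (complex, complex mat list) module" where
  "mat_tuples p q Ss = \<lparr>
     carrier = {xs. list_all2 (\<in>) xs Ss},
     mult = undefined,
     one = undefined,
     zero = replicate (length Ss) (0\<^sub>m p q),
     add = map2 (+),
     smult = (\<lambda>c. map (\<lambda>x. c \<cdot>\<^sub>m x))\<rparr>"

text \<open>The element \<open>(\<zeta>, \<phi>\<^sub>1, \<dots>, \<phi>\<^sub>s)\<close> of the domain is the list \<open>[\<zeta>, \<phi>\<^sub>1, \<dots>, \<phi>\<^sub>s]\<close>.\<close>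

definition Delta_dom :: "nat \<Rightarrow> nat \<Rightarrow> nat set list \<Rightarrow> (complex, complex mat list) module" where
  "Delta_dom n r Is =
     mat_tuples (n - r) r (carrier_mat (n - r) r # map (Hom_flag n r) Is)"

definition Delta_cod :: "nat \<Rightarrow> nat \<Rightarrow> nat \<Rightarrow> (complex, complex mat list) module" where
  "Delta_cod n r s = mat_tuples (n - r) r (replicate s (carrier_mat (n - r) r))"

definition Delta ::
    "complex mat list \<Rightarrow> complex mat list \<Rightarrow> complex mat list \<Rightarrow> complex mat list" where
  "Delta gs hs xs =
     map (\<lambda>k. xs ! 0 + hs ! k * xs ! Suc k * inv_mat (gs ! k)) [0..<length gs]"

definition ordered_basis :: "(complex, 'v) module \<Rightarrow> 'v list \<Rightarrow> bool" where
  "ordered_basis V bs \<longleftrightarrow> distinct bs \<and> vectorspace.basis class_ring V (set bs)"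

text \<open>The matrix of \<open>T\<close> with respect to the basis \<open>bs\<close> of its domain and the basis \<open>cs\<close> of its
  codomain \<open>W\<close>: column \<open>j\<close> holds the coordinates of \<open>T (bs ! j)\<close> in \<open>cs\<close>.\<close>

definition matrix_wrt ::
    "('v \<Rightarrow> 'w) \<Rightarrow> 'v list \<Rightarrow> (complex, 'w) module \<Rightarrow> 'w list \<Rightarrow> complex mat" where
  "matrix_wrt T bs W cs = (THE M. M \<in> carrier_mat (length cs) (length bs) \<and>
     (\<forall>j<length bs. T (bs ! j) = (\<Oplus>\<^bsub>W\<^esub>i \<in> {..<length cs}. M $$ (i, j) \<odot>\<^bsub>W\<^esub> cs ! i)))"

definition det_fun ::
    "nat \<Rightarrow> nat \<Rightarrow> complex mat list list \<Rightarrow> complex mat list list \<Rightarrow>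
     complex mat list \<times> complex mat list \<Rightarrow> complex" where
  "det_fun n r bs cs =
     (\<lambda>(gs, hs). Determinant.det (matrix_wrt (Delta gs hs) bs (Delta_cod n r (length gs)) cs))"

section \<open>Weights and Borel--Weil spaces\<close>

text \<open>A weight of \<open>GL(m)\<close> is an integer list of length \<open>m\<close>.\<close>

definition dual_weight :: "int list \<Rightarrow> int list" where
  "dual_weight w = map uminus (rev w)"

definition weight_of :: "nat set \<Rightarrow> int list" where
  "weight_of I = map (\<lambda>a. int a - int (elt I a)) [1..<Suc (card I)]"

text \<open>A character of the Borel group is trivial on unipotent elements, hence is
  determined by its values on diagonal matrices.\<close>

definition borel_char :: "int list \<Rightarrow> complex mat \<Rightarrow> complex" where
  "borel_char \<mu> b = (\<Prod>a<length \<mu>. (b $$ (a, a)) powi (\<mu> ! a))"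

text \<open>Holomorphy of a function of several complex variables: \<open>f\<close> is complex (Frechet)
  differentiable at every point of \<open>X\<close>, where \<open>coord x i\<close> (\<open>i\<close> ranging over the finite set \<open>J\<close>)
  are the coordinates identifying \<open>X\<close> with an open subset of \<open>\<complex>\<^sup>J\<close>.\<close>

definition holomorphic_wrt ::
    "'i set \<Rightarrow> ('a \<Rightarrow> 'i \<Rightarrow> complex) \<Rightarrow> 'a set \<Rightarrow> ('a \<Rightarrow> complex) \<Rightarrow> bool" where
  "holomorphic_wrt J coord X f \<longleftrightarrow>
     (\<forall>x\<in>X. \<exists>c. \<forall>\<epsilon>>0. \<exists>\<delta>>0. \<forall>y\<in>X.
        (\<Sum>i\<in>J. cmod (coord y i - coord x i)) < \<delta> \<longrightarrow>
        cmod (f y - f x - (\<Sum>i\<in>J. c i * (coord y i - coord x i)))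
          \<le> \<epsilon> * (\<Sum>i\<in>J. cmod (coord y i - coord x i)))"

text \<open>Functions on a group are total functions on matrices of which only the values on the group
  matter.\<close>

definition L_BW :: "int list \<Rightarrow> (complex mat \<Rightarrow> complex) set" where
  "L_BW w = {f.
     holomorphic_wrt ({..<length w} \<times> {..<length w}) (\<lambda>g ij. g $$ ij) (GL (length w)) f \<and>
     (\<forall>g \<in> GL (length w). \<forall>b \<in> borel_GL (length w).
        f (g * b) = f g * borel_char (dual_weight w) b)}"

definition GL_product :: "(int list \<times> int list) list \<Rightarrow> (complex mat list \<times> complex mat list) set"
  where
  "GL_product ws =
     {gs. list_all2 (\<in>) gs (map (\<lambda>(u, v). GL (length u)) ws)} \<times>
     {hs. list_all2 (\<in>) hs (map (\<lambda>(u, v). GL (length v)) ws)}"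

text \<open>For \<open>ws = [(\<lambda>\<^sub>1, \<mu>\<^sub>1), \<dots>, (\<lambda>\<^sub>s, \<mu>\<^sub>s)]\<close>, the tensor product of the spaces
  \<open>L_BW \<lambda>\<^sub>k \<otimes> L_BW \<mu>\<^sub>k\<close> is realized as the space of (jointly) holomorphic functions of
  \<open>(g\<^sub>1, \<dots>, g\<^sub>s, h\<^sub>1, \<dots>, h\<^sub>s)\<close> having the respective equivariance in each argument.\<close>

definition BW_tensor ::
    "(int list \<times> int list) list \<Rightarrow> (complex mat list \<times> complex mat list \<Rightarrow> complex) set" where
  "BW_tensor ws = {f.
     holomorphic_wrt
       ((SIGMA k:{..<length ws}. {..<length (fst (ws ! k))} \<times> {..<length (fst (ws ! k))}) <+>
        (SIGMA k:{..<length ws}. {..<length (snd (ws ! k))} \<times> {..<length (snd (ws ! k))}))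
       (\<lambda>(gs, hs). case_sum (\<lambda>(k, ij). gs ! k $$ ij) (\<lambda>(k, ij). hs ! k $$ ij))
       (GL_product ws) f \<and>
     (\<forall>(gs, hs) \<in> GL_product ws. \<forall>k<length ws.
        (\<lambda>g. f (gs[k := g], hs)) \<in> L_BW (fst (ws ! k)) \<and>
        (\<lambda>h. f (gs, hs[k := h])) \<in> L_BW (snd (ws ! k)))}"

definition diag_action ::
    "complex mat \<Rightarrow> complex mat \<Rightarrow> (complex mat list \<times> complex mat list \<Rightarrow> complex) \<Rightarrow>
     complex mat list \<times> complex mat list \<Rightarrow> complex" where
  "diag_action g g' f =
     (\<lambda>(gs, hs). f (map (\<lambda>x. inv_mat g * x) gs, map (\<lambda>x. inv_mat g' * x) hs))"

end

theory Submission
  imports Defs "Jordan_Normal_Form.Schur_Decomposition" "HOL-Library.Landau_Symbols"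
begin

text \<open>All transformation rules come from one identity. If \<open>h'\<^sub>k a\<^sub>k = a\<^sub>0 h\<^sub>k\<close> and
  \<open>b\<^sub>k g'\<^sub>k\<^sup>-\<^sup>1 = g\<^sub>k\<^sup>-\<^sup>1 b\<^sub>0\<close> for all \<open>k\<close>, then \<open>\<Delta>\<close> at \<open>(g', h')\<close>, composed with
  \<open>(\<zeta>, \<phi>\<^sub>k) \<mapsto> (a\<^sub>0 \<zeta> b\<^sub>0, a\<^sub>k \<phi>\<^sub>k b\<^sub>k)\<close>, equals \<open>\<Delta>\<close> at \<open>(g, h)\<close> followed by
  \<open>y \<mapsto> a\<^sub>0 y b\<^sub>0\<close> in each component. Taking determinants, only the determinants of two-sided
  multiplications remain. On a space of all matrices these are given by powers of the determinants of the
  factors. On a flag-preserving space \<open>H\<^sub>I\<close>, which is spanned by the matrix units in a staircase, and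
  for upper triangular factors, they are products of diagonal entries over the staircase. Its column
  lengths \<open>I(a) - a\<close> give the weight of \<open>I\<close>, and its row lengths, by counting inversions between \<open>I\<close>
  and its complement, give the weight of the complement shifted by \<open>r\<close>. Holomorphy holds because the
  entries of \<open>\<Delta>\<close> are polynomial in \<open>h\<^sub>k\<close> and \<open>g\<^sub>k\<^sup>-\<^sup>1\<close>, and
  \<open>g\<^sub>k\<^sup>-\<^sup>1\<close> is the adjugate over the determinant.\<close>

section \<open>Matrices of linear maps\<close>

text \<open>The bases \<open>bs\<close> and \<open>cs\<close> are arbitrary. The intertwining
  identity tolerates this: the maps before and after \<Delta> are endomorphisms, whose determinants
  do not depend on a basis and may be evaluated in matrix units. The constants come from counting
  blocks. The factors \<open>a 0\<close>, \<open>b 0\<close> act on the free block \<zeta> of the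
  domain and on each of the s blocks of the codomain, each time with determinant
  det(\<open>a 0\<close>)^r det(\<open>b 0\<close>)^(n-r), so the quotient carries the exponent s -
  1. The diagonal action takes \<open>a 0\<close> = g'^-1, \<open>b 0\<close> = g and identities
  elsewhere. For the Borel action on one argument, \<open>a 0\<close> and \<open>b 0\<close> are
  identities and a single upper triangular factor sits on the corresponding flag block. Because g
  enters \<Delta> inverted and h directly, precomposition with b leads from g b back to g, but from
  h on to h b. Hence the column lengths enter the weight with a minus sign and the row lengths with
  a plus sign.\<close>

lemma finsum_nth_basis:
  fixes V :: "(complex, 'v) module"
  assumes V: "vectorspace class_ring V" and d: "distinct bs" and sub: "set bs \<subseteq> carrier V"
  shows "(\<Oplus>\<^bsub>V\<^esub>i\<in>{..<length bs}. c (bs ! i) \<odot>\<^bsub>V\<^esub> bs ! i)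
    = LinearCombinations.module.lincomb V c (set bs)"
proof -
  interpret vectorspace class_ring V by fact
  have b: "bij_betw ((!) bs) {..<length bs} (set bs)"
    using d by (intro bij_betw_nth) auto
  hence im: "(!) bs ` {..<length bs} = set bs" and inj: "inj_on ((!) bs) {..<length bs}"
    by (auto simp: bij_betw_def)
  have "finsum V (\<lambda>v. c v \<odot>\<^bsub>V\<^esub> v) ((!) bs ` {..<length bs})
    = (\<Oplus>\<^bsub>V\<^esub>i\<in>{..<length bs}. c (bs ! i) \<odot>\<^bsub>V\<^esub> bs ! i)"
    by (rule M.add.finprod_reindex[OF _ inj]) (use sub im in auto)
  thus ?thesis unfolding lincomb_def im by simp
qed

text \<open>Library linear combinations take coefficients as a function of the vector,
  \<open>matrix_wrt\<close> takes them by position. Distinctness makes the passage from positions to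
  vectors well defined.\<close>

lemma distinct_nth_fun:
  assumes "distinct bs"
  shows "\<exists>a. \<forall>i<length bs. a (bs ! i) = c i"
proof (intro exI allI impI)
  fix i assume i: "i < length bs"
  have "(THE j. j < length bs \<and> bs ! j = bs ! i) = i"
    using i assms by (intro the_equality) (auto simp: nth_eq_iff_index_eq)
  thus "c (THE j. j < length bs \<and> bs ! j = bs ! i) = c i" by simp
qed

lemma ordered_basisI:
  fixes V :: "(complex, 'v) module"
  assumes V: "vectorspace class_ring V" and d: "distinct bs" and sub: "set bs \<subseteq> carrier V"
    and ind: "\<And>c i. (\<Oplus>\<^bsub>V\<^esub>i\<in>{..<length bs}. c i \<odot>\<^bsub>V\<^esub> bs ! i) = \<zero>\<^bsub>V\<^esub> \<Longrightarrow> i < length bs \<Longrightarrow> c i = 0"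
    and gen: "\<And>v. v \<in> carrier V \<Longrightarrow> \<exists>c. v = (\<Oplus>\<^bsub>V\<^esub>i\<in>{..<length bs}. c i \<odot>\<^bsub>V\<^esub> bs ! i)"
  shows "ordered_basis V bs"
proof -
  interpret vectorspace class_ring V by fact
  have cl: "\<And>i. i < length bs \<Longrightarrow> bs ! i \<in> carrier V" using sub by auto
  have "lin_indpt (set bs)"
  proof (rule finite_lin_indpt2[OF finite_set sub])
    fix a assume "lincomb a (set bs) = \<zero>\<^bsub>V\<^esub>"
    with ind[of "\<lambda>i. a (bs ! i)"] finsum_nth_basis[OF V d sub, of a]
    show "\<forall>v\<in>set bs. a v = \<zero>\<^bsub>class_ring\<^esub>" by (auto simp: in_set_conv_nth)
  qed
  moreover have "span (set bs) = carrier V"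
  proof
    show "span (set bs) \<subseteq> carrier V" using span_closed[OF sub] by blast
    show "carrier V \<subseteq> span (set bs)"
    proof
      fix v assume "v \<in> carrier V"
      then obtain c where c: "v = (\<Oplus>\<^bsub>V\<^esub>i\<in>{..<length bs}. c i \<odot>\<^bsub>V\<^esub> bs ! i)" using gen by blast
      obtain a where a: "\<forall>i<length bs. a (bs ! i) = c i" using distinct_nth_fun[OF d] by metis
      have "v = (\<Oplus>\<^bsub>V\<^esub>i\<in>{..<length bs}. a (bs ! i) \<odot>\<^bsub>V\<^esub> bs ! i)"
        unfolding c by (rule M.finsum_cong') (use a cl in auto)
      hence "v = lincomb a (set bs)" using finsum_nth_basis[OF V d sub] by simp
      thus "v \<in> span (set bs)" unfolding finite_span[OF finite_set sub] by auto
    qed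
  qed
  ultimately show ?thesis using d sub by (simp add: ordered_basis_def basis_def)
qed

lemma basis_expansion:
  fixes V :: "(complex, 'v) module"
  assumes V: "vectorspace class_ring V" and bs: "ordered_basis V bs" and v: "v \<in> carrier V"
  shows "\<exists>c. v = (\<Oplus>\<^bsub>V\<^esub>i\<in>{..<length bs}. c i \<odot>\<^bsub>V\<^esub> bs ! i)"
proof -
  interpret vectorspace class_ring V by fact
  from bs have "distinct bs" "set bs \<subseteq> carrier V" "span (set bs) = carrier V"
    unfolding ordered_basis_def basis_def by auto
  with v finite_in_span[of "set bs" v] obtain a where "lincomb a (set bs) = v" by blast
  with finsum_nth_basis[OF V \<open>distinct bs\<close> \<open>set bs \<subseteq> carrier V\<close>, of a] show ?thesis
    by (intro exI[of _ "\<lambda>i. a (bs ! i)"]) (rule sym, rule trans)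
qed

lemma basis_unique:
  fixes V :: "(complex, 'v) module"
  assumes V: "vectorspace class_ring V" and bs: "ordered_basis V bs"
    and eq: "(\<Oplus>\<^bsub>V\<^esub>i\<in>{..<length bs}. c i \<odot>\<^bsub>V\<^esub> bs ! i) = (\<Oplus>\<^bsub>V\<^esub>i\<in>{..<length bs}. d i \<odot>\<^bsub>V\<^esub> bs ! i)"
    and i: "i < length bs"
  shows "c i = d i"
proof -
  interpret vectorspace class_ring V by fact
  from bs have dis: "distinct bs" and sub: "set bs \<subseteq> carrier V" and li: "lin_indpt (set bs)"
    unfolding ordered_basis_def basis_def by auto
  have cl: "\<And>i. i < length bs \<Longrightarrow> bs ! i \<in> carrier V" using sub by auto
  obtain e where e: "\<And>i. i < length bs \<Longrightarrow> e (bs ! i) = c i - d i"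
    using distinct_nth_fun[OF dis, of "\<lambda>i. c i - d i"] by blast
  \<comment> \<open>Subtraction in the module is avoided: the combination with coefficients
    \<open>c - d\<close> plus the one with coefficients \<open>d\<close> is the one with
    coefficients \<open>c\<close>, and cancellation makes the first one zero.\<close>
  have neg: "(c i - d i) \<odot>\<^bsub>V\<^esub> bs ! i \<oplus>\<^bsub>V\<^esub> d i \<odot>\<^bsub>V\<^esub> bs ! i = c i \<odot>\<^bsub>V\<^esub> bs ! i" if "i < length bs" for i
    using smult_l_distr[of "c i - d i" "d i" "bs ! i"] cl[OF that] by simp
  let ?S = "\<lambda>f. (\<Oplus>\<^bsub>V\<^esub>i\<in>{..<length bs}. f i \<odot>\<^bsub>V\<^esub> bs ! i)"
  have "?S (\<lambda>i. c i - d i) \<oplus>\<^bsub>V\<^esub> ?S d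
     = (\<Oplus>\<^bsub>V\<^esub>i\<in>{..<length bs}. (c i - d i) \<odot>\<^bsub>V\<^esub> bs ! i \<oplus>\<^bsub>V\<^esub> d i \<odot>\<^bsub>V\<^esub> bs ! i)"
    by (rule M.finsum_addf[symmetric]) (use cl in auto)
  also have "\<dots> = ?S c"
    by (rule M.finsum_cong') (use cl neg in auto)
  finally have "?S (\<lambda>i. c i - d i) \<oplus>\<^bsub>V\<^esub> ?S d = ?S d" using eq by simp
  moreover have "?S (\<lambda>i. c i - d i) \<in> carrier V" "?S d \<in> carrier V"
    by (intro M.finsum_closed; use cl in auto)+
  ultimately have z: "?S (\<lambda>i. c i - d i) = \<zero>\<^bsub>V\<^esub>"
    by (simp only: M.add.r_cancel_one)
  have "lincomb e (set bs) = (\<Oplus>\<^bsub>V\<^esub>i\<in>{..<length bs}. e (bs ! i) \<odot>\<^bsub>V\<^esub> bs ! i)"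
    using finsum_nth_basis[OF V dis sub] by simp
  also have "\<dots> = ?S (\<lambda>i. c i - d i)"
    by (rule M.finsum_cong') (use cl e in auto)
  finally have "lincomb e (set bs) = \<zero>\<^bsub>V\<^esub>" using z by simp
  hence "e (bs ! i) = 0"
    using lin_dep_crit[OF finite_set order_refl _ nth_mem[OF i], of e] li by auto
  thus ?thesis using e[OF i] by simp
qed

text \<open>This discharges the definite description in \<open>matrix_wrt\<close>: independence of
  \<open>cs\<close> gives uniqueness, so exhibiting one matrix of coordinates suffices.\<close>

lemma matrix_wrt_eqI:
  assumes W: "vectorspace class_ring W" and cs: "ordered_basis W cs"
    and M: "M \<in> carrier_mat (length cs) (length bs)"
    and eq: "\<And>j. j < length bs \<Longrightarrow> T (bs ! j) = (\<Oplus>\<^bsub>W\<^esub>i \<in> {..<length cs}. M $$ (i, j) \<odot>\<^bsub>W\<^esub> cs ! i)"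
  shows "matrix_wrt T bs W cs = M"
  unfolding matrix_wrt_def
proof (rule the_equality)
  show "M \<in> carrier_mat (length cs) (length bs) \<and>
    (\<forall>j<length bs. T (bs ! j) = (\<Oplus>\<^bsub>W\<^esub>i\<in>{..<length cs}. M $$ (i, j) \<odot>\<^bsub>W\<^esub> cs ! i))"
    using M eq by auto
next
  fix N
  assume N: "N \<in> carrier_mat (length cs) (length bs) \<and>
    (\<forall>j<length bs. T (bs ! j) = (\<Oplus>\<^bsub>W\<^esub>i\<in>{..<length cs}. N $$ (i, j) \<odot>\<^bsub>W\<^esub> cs ! i))"
  show "N = M"
  proof (rule eq_matI)
    fix i j assume "i < dim_row M" "j < dim_col M"
    hence i: "i < length cs" and j: "j < length bs" using M by auto
    show "N $$ (i, j) = M $$ (i, j)"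
      by (rule basis_unique[OF W cs _ i, of "\<lambda>i. N $$ (i, j)" "\<lambda>i. M $$ (i, j)"]) (use N eq j in simp)
  qed (use M N in auto)
qed

lemma matrix_wrt_expansion:
  assumes W: "vectorspace class_ring W" and cs: "ordered_basis W cs"
    and T: "T \<in> set bs \<rightarrow> carrier W"
  shows "matrix_wrt T bs W cs \<in> carrier_mat (length cs) (length bs)"
    and "j < length bs \<Longrightarrow>
      T (bs ! j) = (\<Oplus>\<^bsub>W\<^esub>i \<in> {..<length cs}. matrix_wrt T bs W cs $$ (i, j) \<odot>\<^bsub>W\<^esub> cs ! i)"
proof -
  have "\<forall>j. \<exists>c. j < length bs \<longrightarrow> T (bs ! j) = (\<Oplus>\<^bsub>W\<^esub>i\<in>{..<length cs}. c i \<odot>\<^bsub>W\<^esub> cs ! i)"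
    using basis_expansion[OF W cs] T by (auto dest!: Pi_mem)
  then obtain c where c: "\<And>j. j < length bs \<Longrightarrow>
      T (bs ! j) = (\<Oplus>\<^bsub>W\<^esub>i\<in>{..<length cs}. c j i \<odot>\<^bsub>W\<^esub> cs ! i)"
    by metis
  interpret W: vectorspace class_ring W by fact
  have cl: "\<And>i. i < length cs \<Longrightarrow> cs ! i \<in> carrier W"
    using cs unfolding ordered_basis_def W.basis_def by auto
  define M where "M = mat (length cs) (length bs) (\<lambda>(i, j). c j i)"
  have M: "M \<in> carrier_mat (length cs) (length bs)" by (simp add: M_def)
  have ex: "T (bs ! j) = (\<Oplus>\<^bsub>W\<^esub>i \<in> {..<length cs}. M $$ (i, j) \<odot>\<^bsub>W\<^esub> cs ! i)" if "j < length bs" for j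
    unfolding c[OF that]
    by (rule W.M.finsum_cong') (use that cl in \<open>auto simp: M_def\<close>)
  have "matrix_wrt T bs W cs = M"
    by (rule matrix_wrt_eqI[OF W cs M ex])
  with M ex show "matrix_wrt T bs W cs \<in> carrier_mat (length cs) (length bs)"
    and "j < length bs \<Longrightarrow>
      T (bs ! j) = (\<Oplus>\<^bsub>W\<^esub>i \<in> {..<length cs}. matrix_wrt T bs W cs $$ (i, j) \<odot>\<^bsub>W\<^esub> cs ! i)"
    by auto
qed

lemma matrix_wrt_cong:
  assumes "\<And>v. v \<in> set bs \<Longrightarrow> F v = G v"
  shows "matrix_wrt F bs W cs = matrix_wrt G bs W cs"
proof -
  have "F (bs ! j) = G (bs ! j)" if "j < length bs" for j using assms that by simp
  thus ?thesis unfolding matrix_wrt_def by (metis (no_types, lifting))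
qed

lemma module_hom_finsum:
  fixes V :: "(complex, 'v) module" and W :: "(complex, 'w) module"
  assumes V: "vectorspace class_ring V" and W: "vectorspace class_ring W"
    and F: "F \<in> LinearCombinations.module_hom class_ring V W" and A: "finite A" and b: "b \<in> A \<rightarrow> carrier V"
  shows "F (\<Oplus>\<^bsub>V\<^esub>i\<in>A. c i \<odot>\<^bsub>V\<^esub> b i) = (\<Oplus>\<^bsub>W\<^esub>i\<in>A. c i \<odot>\<^bsub>W\<^esub> F (b i))"
proof -
  interpret V: vectorspace class_ring V by fact
  interpret W: vectorspace class_ring W by fact
  interpret mod_hom class_ring V W F
    by unfold_locales fact
  from A b show ?thesis
  proof (induction A rule: finite_induct)
    case (insert x A)
    have c: "(\<lambda>i. c i \<odot>\<^bsub>V\<^esub> b i) \<in> A \<rightarrow> carrier V" "(\<lambda>i. c i \<odot>\<^bsub>W\<^esub> F (b i)) \<in> A \<rightarrow> carrier W"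
      "b x \<in> carrier V"
      using insert.prems by (auto simp: Pi_iff intro!: V.smult_closed W.smult_closed f_im)
    have "(\<Oplus>\<^bsub>V\<^esub>i\<in>A. c i \<odot>\<^bsub>V\<^esub> b i) \<in> carrier V" by (rule V.M.finsum_closed[OF c(1)])
    with insert c show ?case
      by (simp add: V.M.finsum_insert W.M.finsum_insert)
  qed simp
qed

text \<open>Only \<open>G\<close> is pushed through a linear combination, so \<open>F\<close> has to
  be known on the vectors of \<open>bs\<close> alone.\<close>

lemma matrix_wrt_comp:
  fixes V :: "(complex, 'v) module" and W :: "(complex, 'w) module"
  assumes V: "vectorspace class_ring V" and W: "vectorspace class_ring W"
    and cs: "ordered_basis V cs" and ds: "ordered_basis W ds"
    and F: "F \<in> set bs \<rightarrow> carrier V" and G: "G \<in> LinearCombinations.module_hom class_ring V W"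
  shows "matrix_wrt (\<lambda>x. G (F x)) bs W ds = matrix_wrt G cs W ds * matrix_wrt F bs V cs"
proof (rule matrix_wrt_eqI[OF W ds])
  interpret V: vectorspace class_ring V by fact
  interpret W: vectorspace class_ring W by fact
  interpret G: mod_hom class_ring V W G
    by unfold_locales fact
  have cl: "\<And>i. i < length cs \<Longrightarrow> cs ! i \<in> carrier V"
    using cs unfolding ordered_basis_def V.basis_def by auto
  have dl: "\<And>i. i < length ds \<Longrightarrow> ds ! i \<in> carrier W"
    using ds unfolding ordered_basis_def W.basis_def by auto
  note f = matrix_wrt_expansion[OF V cs F]
  have Gc: "G \<in> set cs \<rightarrow> carrier W" using cs by (auto simp: ordered_basis_def V.basis_def)
  note g = matrix_wrt_expansion[OF W ds Gc]
  let ?A = "matrix_wrt F bs V cs" and ?B = "matrix_wrt G cs W ds"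
  show "?B * ?A \<in> carrier_mat (length ds) (length bs)" using f(1) g(1) by auto
  fix j assume j: "j < length bs"
  have "G (F (bs ! j)) = G (\<Oplus>\<^bsub>V\<^esub>i\<in>{..<length cs}. ?A $$ (i, j) \<odot>\<^bsub>V\<^esub> cs ! i)"
    using f(2)[OF j] by simp
  also have "\<dots> = (\<Oplus>\<^bsub>W\<^esub>i\<in>{..<length cs}. ?A $$ (i, j) \<odot>\<^bsub>W\<^esub> G (cs ! i))"
    by (rule module_hom_finsum[OF V W G]) (use cl in auto)
  also have "\<dots> = (\<Oplus>\<^bsub>W\<^esub>i\<in>{..<length cs}. \<Oplus>\<^bsub>W\<^esub>k\<in>{..<length ds}. (?A $$ (i, j) * ?B $$ (k, i)) \<odot>\<^bsub>W\<^esub> ds ! k)"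
  proof (rule W.M.finsum_cong')
    fix i assume "i \<in> {..<length cs}"
    hence i: "i < length cs" by simp
    have "?A $$ (i, j) \<odot>\<^bsub>W\<^esub> G (cs ! i)
        = (\<Oplus>\<^bsub>W\<^esub>k\<in>{..<length ds}. ?A $$ (i, j) \<odot>\<^bsub>W\<^esub> (?B $$ (k, i) \<odot>\<^bsub>W\<^esub> ds ! k))"
      by (subst g(2)[OF i], rule W.finsum_smult) (use dl in auto)
    also have "\<dots> = (\<Oplus>\<^bsub>W\<^esub>k\<in>{..<length ds}. (?A $$ (i, j) * ?B $$ (k, i)) \<odot>\<^bsub>W\<^esub> ds ! k)"
      by (rule W.M.finsum_cong')
        (use dl W.smult_assoc1 in auto)
    finally show "?A $$ (i, j) \<odot>\<^bsub>W\<^esub> G (cs ! i)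
        = (\<Oplus>\<^bsub>W\<^esub>k\<in>{..<length ds}. (?A $$ (i, j) * ?B $$ (k, i)) \<odot>\<^bsub>W\<^esub> ds ! k)" .
  qed (use dl in auto)
  also have "\<dots> = (\<Oplus>\<^bsub>W\<^esub>k\<in>{..<length ds}. \<Oplus>\<^bsub>W\<^esub>i\<in>{..<length cs}. (?A $$ (i, j) * ?B $$ (k, i)) \<odot>\<^bsub>W\<^esub> ds ! k)"
    by (rule W.M.add.finprod_finprod_swap) (use dl in auto)
  also have "\<dots> = (\<Oplus>\<^bsub>W\<^esub>k\<in>{..<length ds}. (?B * ?A) $$ (k, j) \<odot>\<^bsub>W\<^esub> ds ! k)"
  proof (rule W.M.finsum_cong')
    fix k assume "k \<in> {..<length ds}"
    hence k: "k < length ds" by simp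
    have "(?B * ?A) $$ (k, j) = (\<Sum>i<length cs. ?A $$ (i, j) * ?B $$ (k, i))"
      using f(1) g(1) k j by (auto simp: scalar_prod_def lessThan_atLeast0 mult.commute intro!: sum.cong)
    thus "(\<Oplus>\<^bsub>W\<^esub>i\<in>{..<length cs}. (?A $$ (i, j) * ?B $$ (k, i)) \<odot>\<^bsub>W\<^esub> ds ! k)
      = (?B * ?A) $$ (k, j) \<odot>\<^bsub>W\<^esub> ds ! k"
      using W.finsum_smult_r[OF dl[OF k], of "\<lambda>i. ?A $$ (i, j) * ?B $$ (k, i)" "{..<length cs}"]
      by (simp add: class_ring_simps)
  qed (use dl in auto)
  finally show "G (F (bs ! j)) = \<dots>" .
qed

lemma matrix_wrt_id:
  assumes V: "vectorspace class_ring V" and bs: "ordered_basis V bs"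
  shows "matrix_wrt (\<lambda>x. x) bs V bs = 1\<^sub>m (length bs)"
proof (rule matrix_wrt_eqI[OF V bs])
  interpret V: vectorspace class_ring V by fact
  have cl: "\<And>i. i < length bs \<Longrightarrow> bs ! i \<in> carrier V"
    using bs unfolding ordered_basis_def V.basis_def by auto
  fix j assume j: "j < length bs"
  have "(\<Oplus>\<^bsub>V\<^esub>i\<in>{..<length bs}. 1\<^sub>m (length bs) $$ (i, j) \<odot>\<^bsub>V\<^esub> bs ! i)
     = (\<Oplus>\<^bsub>V\<^esub>i\<in>{..<length bs}. if j = i then bs ! i else \<zero>\<^bsub>V\<^esub>)"
    by (rule V.M.finsum_cong') (use cl j V.smult_l_null V.smult_one in auto)
  also have "\<dots> = bs ! j"
    by (rule V.M.add.finprod_singleton) (use cl j in auto)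
  finally show "bs ! j = (\<Oplus>\<^bsub>V\<^esub>i\<in>{..<length bs}. 1\<^sub>m (length bs) $$ (i, j) \<odot>\<^bsub>V\<^esub> bs ! i)" by simp
qed simp

section \<open>Base change and intertwining maps\<close>

lemma id_module_hom: "(\<lambda>x. x) \<in> LinearCombinations.module_hom R V V"
  by (auto simp: LinearCombinations.module_hom_def)

lemma ordered_basis_subset:
  assumes "vectorspace class_ring V" and "ordered_basis V bs"
  shows "set bs \<subseteq> carrier V"
proof -
  interpret vectorspace class_ring V by fact
  show ?thesis using assms by (simp add: ordered_basis_def basis_def)
qed

lemma ordered_basis_length_eq:
  fixes V :: "(complex, 'v) module"
  assumes V: "vectorspace class_ring V" and bs: "ordered_basis V bs" and es: "ordered_basis V es"
  shows "length bs = length es"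
proof -
  interpret V: vectorspace class_ring V by fact
  have "V.dim = length bs" "V.dim = length es"
    using V.dim_basis[of "set bs"] V.dim_basis[of "set es"] bs es
    by (auto simp: ordered_basis_def distinct_card)
  thus ?thesis by simp
qed

lemma matrix_wrt_carrier:
  assumes V: "vectorspace class_ring V" and W: "vectorspace class_ring W"
    and bs: "ordered_basis V bs" and cs: "ordered_basis W cs"
    and F: "F \<in> LinearCombinations.module_hom class_ring V W"
  shows "matrix_wrt F bs W cs \<in> carrier_mat (length cs) (length bs)"
  by (rule matrix_wrt_expansion(1)[OF W cs])
    (use F ordered_basis_subset[OF V bs] in \<open>auto simp: LinearCombinations.module_hom_def\<close>)

lemma matrix_wrt_comp_hom:
  fixes U :: "(complex, 'u) module" and V :: "(complex, 'v) module" and W :: "(complex, 'w) module"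
  assumes U: "vectorspace class_ring U" and V: "vectorspace class_ring V" and W: "vectorspace class_ring W"
    and bs: "ordered_basis U bs" and cs: "ordered_basis V cs" and ds: "ordered_basis W ds"
    and F: "F \<in> LinearCombinations.module_hom class_ring U V"
    and G: "G \<in> LinearCombinations.module_hom class_ring V W"
  shows "matrix_wrt (\<lambda>x. G (F x)) bs W ds = matrix_wrt G cs W ds * matrix_wrt F bs V cs"
  by (rule matrix_wrt_comp[OF V W cs ds _ G])
    (use F ordered_basis_subset[OF U bs] in \<open>auto simp: LinearCombinations.module_hom_def\<close>)

text \<open>The base change P satisfies P A = B P and has a left inverse R, so its determinant is
  nonzero and cancels. Both bases have the length of the dimension, which makes all matrices
  square.\<close>

lemma det_matrix_wrt_basis_indep:
  fixes V :: "(complex, 'v) module"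
  assumes V: "vectorspace class_ring V" and bs: "ordered_basis V bs" and es: "ordered_basis V es"
    and S: "S \<in> LinearCombinations.module_hom class_ring V V"
  shows "Determinant.det (matrix_wrt S bs V bs) = Determinant.det (matrix_wrt S es V es)"
proof -
  let ?n = "length bs"
  let ?P = "matrix_wrt (\<lambda>x. x) bs V es" and ?R = "matrix_wrt (\<lambda>x. x) es V bs"
  let ?A = "matrix_wrt S bs V bs" and ?B = "matrix_wrt S es V es"
  note len = ordered_basis_length_eq[OF V es bs]
  note car = matrix_wrt_carrier[OF V V]
  note comp = matrix_wrt_comp_hom[OF V V V]
  have P: "?P \<in> carrier_mat ?n ?n" using car[OF bs es id_module_hom] len by simp
  have R: "?R \<in> carrier_mat ?n ?n" using car[OF es bs id_module_hom] len by simp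
  have A: "?A \<in> carrier_mat ?n ?n" using car[OF bs bs S] by simp
  have B: "?B \<in> carrier_mat ?n ?n" using car[OF es es S] len by simp
  have RP: "?R * ?P = 1\<^sub>m ?n"
    using comp[OF bs es bs id_module_hom id_module_hom] matrix_wrt_id[OF V bs] by simp
  have "?P * ?A = ?B * ?P"
    using comp[OF bs bs es S id_module_hom] comp[OF bs es es id_module_hom S] by simp
  hence "Determinant.det ?P * Determinant.det ?A = Determinant.det ?B * Determinant.det ?P"
    using det_mult[OF P A] det_mult[OF B P] by metis
  moreover have "Determinant.det ?R * Determinant.det ?P = 1"
    using det_mult[OF R P] RP by simp
  hence "Determinant.det ?P \<noteq> 0" by auto
  ultimately show ?thesis by (simp add: mult.commute)
qed

text \<open>This is multiplicativity of the determinant applied to F' S = T F. \<open>F\<close> and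
  \<open>F'\<close> are read in the same pair of bases, so the rule compares them through the
  intrinsic determinants of \<open>S\<close> and \<open>T\<close>.\<close>

lemma det_matrix_wrt_intertwine:
  fixes V :: "(complex, 'v) module" and W :: "(complex, 'w) module"
  assumes V: "vectorspace class_ring V" and W: "vectorspace class_ring W"
    and bs: "ordered_basis V bs" and cs: "ordered_basis W cs"
    and F: "F \<in> LinearCombinations.module_hom class_ring V W"
    and F': "F' \<in> LinearCombinations.module_hom class_ring V W"
    and S: "S \<in> LinearCombinations.module_hom class_ring V V"
    and T: "T \<in> LinearCombinations.module_hom class_ring W W"
    and eq: "\<And>v. v \<in> carrier V \<Longrightarrow> F' (S v) = T (F v)"
  shows "Determinant.det (matrix_wrt F' bs W cs) * Determinant.det (matrix_wrt S bs V bs)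
    = Determinant.det (matrix_wrt T cs W cs) * Determinant.det (matrix_wrt F bs W cs)"
proof -
  let ?F = "matrix_wrt F bs W cs" and ?F' = "matrix_wrt F' bs W cs"
    and ?S = "matrix_wrt S bs V bs" and ?T = "matrix_wrt T cs W cs"
  have car: "?F \<in> carrier_mat (length cs) (length bs)" "?F' \<in> carrier_mat (length cs) (length bs)"
    "?S \<in> carrier_mat (length bs) (length bs)" "?T \<in> carrier_mat (length cs) (length cs)"
    by (rule matrix_wrt_carrier[OF V W bs cs F] matrix_wrt_carrier[OF V W bs cs F']
      matrix_wrt_carrier[OF V V bs bs S] matrix_wrt_carrier[OF W W cs cs T])+
  show ?thesis
  proof (cases "length bs = length cs")
    case True
    have "?F' * ?S = matrix_wrt (\<lambda>x. F' (S x)) bs W cs"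
      by (rule matrix_wrt_comp_hom[symmetric, OF V V W bs bs cs S F'])
    also have "\<dots> = matrix_wrt (\<lambda>x. T (F x)) bs W cs"
      by (rule matrix_wrt_cong) (use eq ordered_basis_subset[OF V bs] in auto)
    also have "\<dots> = ?T * ?F"
      by (rule matrix_wrt_comp_hom[OF V W W bs cs cs F T])
    finally have "?F' * ?S = ?T * ?F" .
    thus ?thesis using car True det_mult[of ?F' "length bs" ?S] det_mult[of ?T "length bs" ?F] by simp
  next
    case False \<comment> \<open>the determinant of a non-square matrix is 0 by convention\<close>
    hence "Determinant.det ?F = 0" "Determinant.det ?F' = 0"
      using car unfolding Determinant.det_def by auto
    thus ?thesis by simp
  qed
qed

section \<open>Tuples of matrices with prescribed support\<close>

definition supp_mats :: "nat \<Rightarrow> nat \<Rightarrow> (nat \<times> nat) set \<Rightarrow> complex mat set" where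
  "supp_mats p q D = {x \<in> carrier_mat p q. \<forall>i<p. \<forall>j<q. (i, j) \<notin> D \<longrightarrow> x $$ (i, j) = 0}"

text \<open>The domain and the codomain of \<Delta> are both of this form, with \<open>D\<close>
  listing the allowed positions as block, row, column. One basis of matrix units and one determinant
  formula then serve for both.\<close>

definition tuple_space ::
    "nat \<Rightarrow> nat \<Rightarrow> nat \<Rightarrow> (nat \<times> nat \<times> nat) set \<Rightarrow> (complex, complex mat list) module" where
  "tuple_space p q m D = mat_tuples p q (map (\<lambda>k. supp_mats p q (D `` {k})) [0..<m])"

lemma tuple_space_carrier:
  "xs \<in> carrier (tuple_space p q m D) \<longleftrightarrow> length xs = m \<and>
    (\<forall>k<m. xs ! k \<in> carrier_mat p q \<and>
      (\<forall>i<p. \<forall>j<q. (k, i, j) \<notin> D \<longrightarrow> xs ! k $$ (i, j) = 0))"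
  by (auto simp: tuple_space_def mat_tuples_def supp_mats_def list_all2_conv_all_nth)

lemma tuple_space_add:
  "xs \<oplus>\<^bsub>tuple_space p q m D\<^esub> ys = map2 (+) xs ys"
  by (simp add: tuple_space_def mat_tuples_def)

lemma tuple_space_smult:
  "c \<odot>\<^bsub>tuple_space p q m D\<^esub> xs = map (\<lambda>x. c \<cdot>\<^sub>m x) xs"
  by (simp add: tuple_space_def mat_tuples_def)

lemma tuple_space_zero:
  "\<zero>\<^bsub>tuple_space p q m D\<^esub> = replicate m (0\<^sub>m p q)"
  by (simp add: tuple_space_def mat_tuples_def)

lemmas tuple_space_simps = tuple_space_carrier tuple_space_add tuple_space_smult tuple_space_zero

lemma tuple_eqI:
  assumes "length xs = m" and "length ys = m"
    and "\<And>k. k < m \<Longrightarrow> xs ! k \<in> carrier_mat p q" and "\<And>k. k < m \<Longrightarrow> ys ! k \<in> carrier_mat p q"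
    and "\<And>k i j. k < m \<Longrightarrow> i < p \<Longrightarrow> j < q \<Longrightarrow> xs ! k $$ (i, j) = ys ! k $$ (i, j)"
  shows "xs = ys"
proof (rule nth_equalityI)
  fix k assume "k < length xs"
  hence k: "k < m" using assms(1) by simp
  show "xs ! k = ys ! k" by (rule eq_matI) (use assms(3-5)[OF k] in auto)
qed (use assms in simp)

lemma tuple_space_vectorspace: "vectorspace class_ring (tuple_space p q m D)"
proof (rule vs_criteria)
  show "field (class_ring :: complex ring)" by (rule class_field)
  let ?V = "tuple_space p q m D"
  show "\<zero>\<^bsub>?V\<^esub> \<in> carrier ?V" by (simp add: tuple_space_simps)
  show "\<forall>v w. v \<in> carrier ?V \<and> w \<in> carrier ?V \<longrightarrow> v \<oplus>\<^bsub>?V\<^esub> w \<in> carrier ?V"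
    by (auto simp: tuple_space_simps)
  show "\<forall>c v. c \<in> carrier class_ring \<and> v \<in> carrier ?V \<longrightarrow> c \<odot>\<^bsub>?V\<^esub> v \<in> carrier ?V"
    by (auto simp: tuple_space_simps)
  show "\<forall>v\<in>carrier ?V. \<exists>neg_v\<in>carrier ?V. v \<oplus>\<^bsub>?V\<^esub> neg_v = \<zero>\<^bsub>?V\<^esub>"
  proof
    fix v assume v: "v \<in> carrier ?V"
    have "v \<oplus>\<^bsub>?V\<^esub> map (\<lambda>x. -1 \<cdot>\<^sub>m x) v = \<zero>\<^bsub>?V\<^esub>"
      by (rule tuple_eqI[where m = m and p = p and q = q]) (use v in \<open>auto simp: tuple_space_simps\<close>)
    moreover have "map (\<lambda>x. -1 \<cdot>\<^sub>m x) v \<in> carrier ?V" using v by (auto simp: tuple_space_simps)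
    ultimately show "\<exists>neg_v\<in>carrier ?V. v \<oplus>\<^bsub>?V\<^esub> neg_v = \<zero>\<^bsub>?V\<^esub>" by blast
  qed
  show "\<forall>v w. v \<in> carrier ?V \<and> w \<in> carrier ?V \<longrightarrow> v \<oplus>\<^bsub>?V\<^esub> w = w \<oplus>\<^bsub>?V\<^esub> v"
    by (intro allI impI, rule tuple_eqI[where m = m and p = p and q = q])
      (auto simp: tuple_space_simps comm_add_mat[where nr = p and nc = q])
  show "\<forall>v w x. v \<in> carrier ?V \<and> w \<in> carrier ?V \<and> x \<in> carrier ?V \<longrightarrow>
      (v \<oplus>\<^bsub>?V\<^esub> w) \<oplus>\<^bsub>?V\<^esub> x = v \<oplus>\<^bsub>?V\<^esub> (w \<oplus>\<^bsub>?V\<^esub> x)"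
    by (intro allI impI, rule tuple_eqI[where m = m and p = p and q = q]) (auto simp: tuple_space_simps)
  show "\<forall>v\<in>carrier ?V. v \<oplus>\<^bsub>?V\<^esub> \<zero>\<^bsub>?V\<^esub> = v"
    by (intro ballI, rule tuple_eqI[where m = m and p = p and q = q]) (auto simp: tuple_space_simps)
  show "\<forall>a b v. a \<in> carrier class_ring \<and> b \<in> carrier class_ring \<and> v \<in> carrier ?V \<longrightarrow>
      (a \<otimes>\<^bsub>class_ring\<^esub> b) \<odot>\<^bsub>?V\<^esub> v = a \<odot>\<^bsub>?V\<^esub> (b \<odot>\<^bsub>?V\<^esub> v)"
    by (intro allI impI, rule tuple_eqI[where m = m and p = p and q = q]) (auto simp: tuple_space_simps)
  show "\<forall>v\<in>carrier ?V. \<one>\<^bsub>class_ring\<^esub> \<odot>\<^bsub>?V\<^esub> v = v"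
    by (intro ballI, rule tuple_eqI[where m = m and p = p and q = q]) (auto simp: tuple_space_simps)
  show "\<forall>a b v. a \<in> carrier class_ring \<and> b \<in> carrier class_ring \<and> v \<in> carrier ?V \<longrightarrow>
      (a \<oplus>\<^bsub>class_ring\<^esub> b) \<odot>\<^bsub>?V\<^esub> v = (a \<odot>\<^bsub>?V\<^esub> v) \<oplus>\<^bsub>?V\<^esub> (b \<odot>\<^bsub>?V\<^esub> v)"
    by (intro allI impI, rule tuple_eqI[where m = m and p = p and q = q])
      (auto simp: tuple_space_simps distrib_right)
  show "\<forall>a v w. a \<in> carrier class_ring \<and> v \<in> carrier ?V \<and> w \<in> carrier ?V \<longrightarrow>
      a \<odot>\<^bsub>?V\<^esub> (v \<oplus>\<^bsub>?V\<^esub> w) = (a \<odot>\<^bsub>?V\<^esub> v) \<oplus>\<^bsub>?V\<^esub> (a \<odot>\<^bsub>?V\<^esub> w)"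
    by (intro allI impI, rule tuple_eqI[where m = m and p = p and q = q])
      (auto simp: tuple_space_simps add_smult_distrib_left_mat[where nr = p and nc = q])
qed

lemma tuple_space_finsum:
  assumes f: "f \<in> A \<rightarrow> carrier (tuple_space p q m D)" and A: "finite A"
    and k: "k < m" and i: "i < p" and j: "j < q"
  shows "finsum (tuple_space p q m D) f A ! k $$ (i, j) = (\<Sum>a\<in>A. f a ! k $$ (i, j))"
  using A f
proof (induction A rule: finite_induct)
  interpret vectorspace class_ring "tuple_space p q m D" by (rule tuple_space_vectorspace)
  case empty
  show ?case using k i j by (simp add: tuple_space_zero)
next
  interpret vectorspace class_ring "tuple_space p q m D" by (rule tuple_space_vectorspace)
  case (insert x A)
  hence fx: "f x \<in> carrier (tuple_space p q m D)" and fA: "f \<in> A \<rightarrow> carrier (tuple_space p q m D)" by auto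
  have "finsum (tuple_space p q m D) f A \<in> carrier (tuple_space p q m D)"
    by (rule M.finsum_closed[OF fA])
  with fx insert.IH[OF fA] insert.hyps k i j show ?case
    by (auto simp: M.finsum_insert[OF insert.hyps fA fx] tuple_space_add tuple_space_carrier)
qed

definition unit_tuple :: "nat \<Rightarrow> nat \<Rightarrow> nat \<Rightarrow> nat \<times> nat \<times> nat \<Rightarrow> complex mat list" where
  "unit_tuple p q m t = map (\<lambda>k. mat p q (\<lambda>(i, j). if t = (k, i, j) then 1 else 0)) [0..<m]"

lemma unit_tuple_nth:
  assumes "k < m" and "i < p" and "j < q"
  shows "unit_tuple p q m t ! k $$ (i, j) = (if t = (k, i, j) then 1 else 0)"
  using assms by (simp add: unit_tuple_def)

lemma unit_tuple_carrier:
  assumes "t \<in> D"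
  shows "unit_tuple p q m t \<in> carrier (tuple_space p q m D)"
  using assms by (auto simp: tuple_space_carrier unit_tuple_def)

text \<open>The list \<open>ts\<close> orders the positions in \<open>D\<close>, so that a position
  can serve as a row or column index of a matrix.\<close>

context
  fixes p q m :: nat and D :: "(nat \<times> nat \<times> nat) set" and ts :: "(nat \<times> nat \<times> nat) list"
  assumes D: "D \<subseteq> {..<m} \<times> {..<p} \<times> {..<q}" and ts: "set ts = D" "distinct ts"
begin

lemma unit_tuple_nth_carrier:
  "l < length ts \<Longrightarrow> unit_tuple p q m (ts ! l) \<in> carrier (tuple_space p q m D)"
  using ts by (auto intro: unit_tuple_carrier)

text \<open>At the position \<open>ts ! l\<close> only the l-th matrix unit is nonzero. Coordinates
  are therefore entries, which yields independence as well as the explicit expansion below.\<close>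

lemma unit_tuples_combination_nth:
  assumes "l < length ts" and "ts ! l = (k, i, j)"
  shows "(\<Oplus>\<^bsub>tuple_space p q m D\<^esub>l\<in>{..<length ts}. c l \<odot>\<^bsub>tuple_space p q m D\<^esub> map (unit_tuple p q m) ts ! l)
    ! k $$ (i, j) = c l"
proof -
  interpret vectorspace class_ring "tuple_space p q m D" by (rule tuple_space_vectorspace)
  have kij: "k < m" "i < p" "j < q" using assms D ts nth_mem[of l ts] by auto
  have cl: "map (unit_tuple p q m) ts ! l \<in> carrier (tuple_space p q m D)" if "l < length ts" for l
    using that ts by (auto intro: unit_tuple_carrier)
  have "(\<Oplus>\<^bsub>tuple_space p q m D\<^esub>l\<in>{..<length ts}. c l \<odot>\<^bsub>tuple_space p q m D\<^esub> map (unit_tuple p q m) ts ! l)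
      ! k $$ (i, j)
    = (\<Sum>l<length ts. (c l \<odot>\<^bsub>tuple_space p q m D\<^esub> map (unit_tuple p q m) ts ! l) ! k $$ (i, j))"
    by (rule tuple_space_finsum) (use cl kij in \<open>auto intro!: smult_closed\<close>)
  also have "\<dots> = (\<Sum>l'<length ts. if l' = l then c l' else 0)"
  proof (rule sum.cong)
    fix l' assume l': "l' \<in> {..<length ts}"
    have "ts ! l' = (k, i, j) \<longleftrightarrow> l' = l"
      using l' assms ts nth_eq_iff_index_eq[of ts l' l] by auto
    thus "(c l' \<odot>\<^bsub>tuple_space p q m D\<^esub> map (unit_tuple p q m) ts ! l') ! k $$ (i, j) = (if l' = l then c l' else 0)"
      using l' kij by (simp add: tuple_space_smult unit_tuple_def)
  qed simp
  also have "\<dots> = c l" using assms by simp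
  finally show ?thesis .
qed

lemma unit_tuples_expansion:
  assumes x: "x \<in> carrier (tuple_space p q m D)"
  shows "x = (\<Oplus>\<^bsub>tuple_space p q m D\<^esub>l\<in>{..<length ts}.
    (case ts ! l of (k, i, j) \<Rightarrow> x ! k $$ (i, j)) \<odot>\<^bsub>tuple_space p q m D\<^esub> map (unit_tuple p q m) ts ! l)"
    (is "_ = ?s")
proof (rule tuple_eqI[where m = m and p = p and q = q])
  interpret vectorspace class_ring "tuple_space p q m D" by (rule tuple_space_vectorspace)
  have s: "?s \<in> carrier (tuple_space p q m D)"
    by (intro M.finsum_closed) (auto intro!: smult_closed unit_tuple_nth_carrier)
  show "length x = m" "length ?s = m" using x s by (auto simp: tuple_space_carrier)
  fix k assume k: "k < m"
  show "x ! k \<in> carrier_mat p q" "?s ! k \<in> carrier_mat p q" using x s k by (auto simp: tuple_space_carrier)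
  fix i j assume ij: "i < p" "j < q"
  show "x ! k $$ (i, j) = ?s ! k $$ (i, j)"
  proof (cases "(k, i, j) \<in> D")
    case True
    then obtain l where "l < length ts" "ts ! l = (k, i, j)" using ts by (metis in_set_conv_nth)
    from unit_tuples_combination_nth[OF this] this show ?thesis by simp
  next
    case False
    thus ?thesis using x s k ij by (simp add: tuple_space_carrier)
  qed
qed

lemma unit_tuples_basis: "ordered_basis (tuple_space p q m D) (map (unit_tuple p q m) ts)"
proof (rule ordered_basisI[OF tuple_space_vectorspace])
  show "distinct (map (unit_tuple p q m) ts)"
    unfolding distinct_map
  proof (intro conjI inj_onI)
    fix s t assume st: "s \<in> set ts" "t \<in> set ts" "unit_tuple p q m s = unit_tuple p q m t"
    obtain k i j where s: "s = (k, i, j)" by (cases s)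
    with st D ts have "k < m" "i < p" "j < q" by auto
    from unit_tuple_nth[OF this] st(3) s show "s = t" by (metis one_neq_zero)
  qed (rule ts)
  show "set (map (unit_tuple p q m) ts) \<subseteq> carrier (tuple_space p q m D)"
    using ts by (auto intro: unit_tuple_carrier)
next
  fix c l
  assume z: "(\<Oplus>\<^bsub>tuple_space p q m D\<^esub>l\<in>{..<length (map (unit_tuple p q m) ts)}.
      c l \<odot>\<^bsub>tuple_space p q m D\<^esub> map (unit_tuple p q m) ts ! l) = \<zero>\<^bsub>tuple_space p q m D\<^esub>"
    and l: "l < length (map (unit_tuple p q m) ts)"
  obtain k i j where t: "ts ! l = (k, i, j)" by (cases "ts ! l")
  have "k < m" "i < p" "j < q" using l D ts t nth_mem[of l ts] by auto
  with unit_tuples_combination_nth[OF _ t, of c] l z show "c l = 0" by (simp add: tuple_space_zero)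
next
  fix v assume "v \<in> carrier (tuple_space p q m D)"
  from unit_tuples_expansion[OF this]
  show "\<exists>c. v = (\<Oplus>\<^bsub>tuple_space p q m D\<^esub>l\<in>{..<length (map (unit_tuple p q m) ts)}.
      c l \<odot>\<^bsub>tuple_space p q m D\<^esub> map (unit_tuple p q m) ts ! l)"
    by (intro exI) simp
qed

text \<open>Reading coordinates off as entries makes two things visible: the triangular shape of
  two-sided multiplications, and the dependence of \<Delta> on the group elements.\<close>

lemma matrix_wrt_unit_tuples:
  assumes F: "F \<in> set bs \<rightarrow> carrier (tuple_space p q m D)"
  shows "matrix_wrt F bs (tuple_space p q m D) (map (unit_tuple p q m) ts)
    = mat (length ts) (length bs) (\<lambda>(l, l'). case ts ! l of (k, i, j) \<Rightarrow> F (bs ! l') ! k $$ (i, j))"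
proof (rule matrix_wrt_eqI[OF tuple_space_vectorspace unit_tuples_basis])
  interpret vectorspace class_ring "tuple_space p q m D" by (rule tuple_space_vectorspace)
  fix l' assume l': "l' < length bs"
  hence "F (bs ! l') \<in> carrier (tuple_space p q m D)" using F by auto
  from unit_tuples_expansion[OF this]
  have "F (bs ! l') = (\<Oplus>\<^bsub>tuple_space p q m D\<^esub>l\<in>{..<length ts}.
    (case ts ! l of (k, i, j) \<Rightarrow> F (bs ! l') ! k $$ (i, j)) \<odot>\<^bsub>tuple_space p q m D\<^esub> map (unit_tuple p q m) ts ! l)" .
  also have "\<dots> = (\<Oplus>\<^bsub>tuple_space p q m D\<^esub>l\<in>{..<length (map (unit_tuple p q m) ts)}.
    mat (length ts) (length bs) (\<lambda>(l, l'). case ts ! l of (k, i, j) \<Rightarrow> F (bs ! l') ! k $$ (i, j)) $$ (l, l')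
    \<odot>\<^bsub>tuple_space p q m D\<^esub> map (unit_tuple p q m) ts ! l)"
    by (rule M.finsum_cong') (use l' in \<open>auto intro!: smult_closed unit_tuple_nth_carrier\<close>)
  finally show "F (bs ! l') = \<dots>" .
qed simp

end

section \<open>Determinants of two-sided multiplications\<close>

text \<open>If all nonzero off-diagonal entries increase the rank \<open>rk\<close>, a permutation with nonzero
  contribution never lowers the rank; as it preserves the sum of all ranks, it is the identity.\<close>

lemma det_rank_triangular:
  fixes A :: "'a :: comm_ring_1 mat" and rk :: "nat \<Rightarrow> int"
  assumes A: "A \<in> carrier_mat n n"
    and tri: "\<And>i j. i < n \<Longrightarrow> j < n \<Longrightarrow> A $$ (i, j) \<noteq> 0 \<Longrightarrow> i = j \<or> rk i < rk j"
  shows "Determinant.det A = (\<Prod>i<n. A $$ (i, i))"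
proof -
  let ?P = "{p. p permutes {0..<n}}"
  let ?f = "\<lambda>p. signof p * (\<Prod>i = 0..<n. A $$ (i, p i))"
  have z: "?f p = 0" if p: "p \<in> ?P - {id}" for p
  proof -
    from p have perm: "p permutes {0..<n}" and ne: "p \<noteq> id" by auto
    have "\<exists>i\<in>{0..<n}. A $$ (i, p i) = 0"
    proof (rule ccontr)
      assume "\<not> ?thesis"
      hence nz: "A $$ (i, p i) \<noteq> 0" if "i < n" for i using that by auto
      have step: "i = p i \<or> rk i < rk (p i)" if "i < n" for i
        using tri[OF that _ nz[OF that]] permutes_in_image[OF perm, of i] that by auto
      obtain i where i: "i < n" "p i \<noteq> i"
        using ne perm by (metis atLeastLessThan_iff eq_id_iff permutes_not_in zero_le)
      have "(\<Sum>i\<in>{0..<n}. rk i) < (\<Sum>i\<in>{0..<n}. rk (p i))"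
        by (rule sum_strict_mono_ex1) (use step i in \<open>force+\<close>)
      also have "\<dots> = (\<Sum>i\<in>{0..<n}. rk i)"
        using sum.permute[OF perm, of rk] by (simp add: o_def)
      finally show False by simp
    qed
    thus ?thesis by (metis (mono_tags, lifting) finite_atLeastLessThan mult_zero_right prod_zero)
  qed
  have "Determinant.det A = (\<Sum>p\<in>?P. ?f p)" by (rule det_def'[OF A])
  also have "\<dots> = ?f id + (\<Sum>p\<in>?P - {id}. ?f p)"
    by (rule sum.remove) (auto simp: finite_permutations permutes_id)
  also have "(\<Sum>p\<in>?P - {id}. ?f p) = 0" using z by (rule sum.neutral[OF ballI])
  finally show ?thesis by (simp add: sign_id lessThan_atLeast0)
qed

lemma det_upper_triangular_prod:
  fixes A :: "'a :: comm_ring_1 mat"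
  assumes A: "A \<in> carrier_mat n n" and tri: "upper_triangular A"
  shows "Determinant.det A = (\<Prod>i<n. A $$ (i, i))"
proof (rule det_rank_triangular[OF A, of int])
  fix i j assume "i < n" "j < n" "A $$ (i, j) \<noteq> 0"
  with upper_triangularD[OF tri, of j i] A have "\<not> j < i" by auto
  thus "i = j \<or> int i < int j" by auto
qed

section \<open>Triangularization and two-sided multiplication\<close>

lemma upper_triangular_one: "upper_triangular (1\<^sub>m n)"
  by (rule upper_triangularI) simp

text \<open>The characteristic polynomial splits over the complex numbers, so a Schur decomposition
  exists. Both forms of the conjugation are recorded because a left factor is moved past P on its
  right and a right factor past Q on its left.\<close>

lemma schur_triangularization:
  fixes A :: "complex mat"
  assumes A: "A \<in> carrier_mat n n"
  shows "\<exists>T P Q. T \<in> carrier_mat n n \<and> P \<in> carrier_mat n n \<and> Q \<in> carrier_mat n n \<and>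
    upper_triangular T \<and> A * P = P * T \<and> Q * A = T * Q \<and> P * Q = 1\<^sub>m n \<and> Q * P = 1\<^sub>m n \<and>
    (\<Prod>i<n. T $$ (i, i)) = Determinant.det A"
proof -
  obtain es where es: "char_poly A = (\<Prod>e\<leftarrow>es. [:- e, 1:])"
    using char_poly_factorized[OF A] by blast
  obtain T P Q where dec: "schur_decomposition A es = (T, P, Q)" by (cases "schur_decomposition A es")
  from schur_decomposition[OF A es dec]
  have wit: "similar_mat_wit A T P Q" and T: "upper_triangular T" by auto
  note w = similar_mat_witD2[OF A wit]
  have Tc: "T \<in> carrier_mat n n" and Pc: "P \<in> carrier_mat n n" and Qc: "Q \<in> carrier_mat n n"
    and PQ: "P * Q = 1\<^sub>m n" and QP: "Q * P = 1\<^sub>m n" and eq: "A = P * T * Q"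
    using w by auto
  have "A * P = P * T * (Q * P)"
    unfolding eq using Tc Pc Qc by (intro assoc_mult_mat) auto
  hence AP: "A * P = P * T" using QP Pc Tc by simp
  have "Q * A = Q * P * (T * Q)"
    unfolding eq using Tc Pc Qc by (simp add: assoc_mult_mat[of _ n n _ n _ n])
  hence QA: "Q * A = T * Q" using QP Tc Qc by simp
  have "Determinant.det P * Determinant.det Q = 1"
    using det_mult[OF Pc Qc] PQ by simp
  moreover have "Determinant.det A = Determinant.det P * Determinant.det T * Determinant.det Q"
    unfolding eq using det_mult[OF mult_carrier_mat[OF Pc Tc] Qc] det_mult[OF Pc Tc] by simp
  ultimately have "Determinant.det A = Determinant.det T" by (simp add: algebra_simps)
  moreover have "Determinant.det T = (\<Prod>i<n. T $$ (i, i))" by (rule det_upper_triangular_prod[OF Tc T])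
  ultimately have "(\<Prod>i<n. T $$ (i, i)) = Determinant.det A" by simp
  with Tc Pc Qc PQ QP AP QA T show ?thesis by blast
qed

definition two_sided_mult ::
    "(nat \<Rightarrow> complex mat) \<Rightarrow> (nat \<Rightarrow> complex mat) \<Rightarrow> complex mat list \<Rightarrow> complex mat list" where
  "two_sided_mult a b xs = map (\<lambda>k. a k * xs ! k * b k) [0..<length xs]"

lemma mat_mult3_nth:
  fixes A :: "'a :: semiring_0 mat"
  assumes "A \<in> carrier_mat p p" and "X \<in> carrier_mat p q" and "B \<in> carrier_mat q q"
    and "i < p" and "j < q"
  shows "(A * X * B) $$ (i, j) = (\<Sum>j'<q. (\<Sum>i'<p. A $$ (i, i') * X $$ (i', j')) * B $$ (j', j))"
proof -
  have AX: "A * X \<in> carrier_mat p q" using assms by simp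
  have "(A * X * B) $$ (i, j) = (\<Sum>j'<q. (A * X) $$ (i, j') * B $$ (j', j))"
    using AX assms by (subst index_mult_mat) (auto simp: scalar_prod_def lessThan_atLeast0 intro!: sum.cong)
  also have "\<dots> = (\<Sum>j'<q. (\<Sum>i'<p. A $$ (i, i') * X $$ (i', j')) * B $$ (j', j))"
    using assms(1,2,4) by (intro sum.cong) (auto simp: scalar_prod_def lessThan_atLeast0)
  finally show ?thesis .
qed

text \<open>Here \<open>K\<close> collects the indices of blocks without vanishing conditions. On the other blocks, only
  multiplication by upper triangular matrices preserves the staircase shape.\<close>

locale staircase =
  fixes p q m :: nat and D :: "(nat \<times> nat \<times> nat) set" and K :: "nat set"
  assumes D_subset: "D \<subseteq> {..<m} \<times> {..<p} \<times> {..<q}"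
    and D_full: "k < m \<Longrightarrow> k \<in> K \<Longrightarrow> i < p \<Longrightarrow> j < q \<Longrightarrow> (k, i, j) \<in> D"
    and D_stair: "(k, i', j') \<in> D \<Longrightarrow> i \<le> i' \<Longrightarrow> j' \<le> j \<Longrightarrow> j < q \<Longrightarrow> (k, i, j) \<in> D"
begin

abbreviation "V \<equiv> tuple_space p q m D"

definition admissible :: "(nat \<Rightarrow> complex mat) \<Rightarrow> (nat \<Rightarrow> complex mat) \<Rightarrow> bool" where
  "admissible a b \<longleftrightarrow> (\<forall>k<m. a k \<in> carrier_mat p p \<and> b k \<in> carrier_mat q q \<and>
    (k \<notin> K \<longrightarrow> upper_triangular (a k) \<and> upper_triangular (b k)))"

text \<open>A position outside \<open>D\<close> lies in a block not in \<open>K\<close>, where both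
  factors are upper triangular. The entry at (i, j) then involves only entries of \<open>x\<close>
  at (i', j') with i \<le> i' and j' \<le> j, and by the staircase condition none of these positions
  lies in \<open>D\<close>.\<close>

lemma two_sided_mult_closed:
  assumes ab: "admissible a b" and x: "x \<in> carrier V"
  shows "two_sided_mult a b x \<in> carrier V"
  unfolding tuple_space_carrier
proof (intro conjI allI impI)
  show "length (two_sided_mult a b x) = m" using x by (simp add: two_sided_mult_def tuple_space_carrier)
  fix k assume k: "k < m"
  have car: "a k \<in> carrier_mat p p" "x ! k \<in> carrier_mat p q" "b k \<in> carrier_mat q q"
    using ab x k by (auto simp: admissible_def tuple_space_carrier)
  have eq: "two_sided_mult a b x ! k = a k * x ! k * b k"
    using x k by (simp add: two_sided_mult_def tuple_space_carrier)
  show "two_sided_mult a b x ! k \<in> carrier_mat p q" using eq car by simp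
  fix i j assume i: "i < p" and j: "j < q" and nD: "(k, i, j) \<notin> D"
  hence kK: "k \<notin> K" using D_full k by auto
  have zero: "a k $$ (i, i') * x ! k $$ (i', j') * b k $$ (j', j) = 0" if "i' < p" "j' < q" for i' j'
  proof (cases "i \<le> i' \<and> j' \<le> j")
    case True
    hence "(k, i', j') \<notin> D" using D_stair nD j by blast
    thus ?thesis using x k that by (simp add: tuple_space_carrier)
  next
    case False
    hence "a k $$ (i, i') = 0 \<or> b k $$ (j', j) = 0"
      using ab k kK car i that upper_triangularD[of "a k" i' i] upper_triangularD[of "b k" j j']
      by (auto simp: admissible_def)
    thus ?thesis by auto
  qed
  show "two_sided_mult a b x ! k $$ (i, j) = 0"
    unfolding eq mat_mult3_nth[OF car i j] sum_distrib_right using zero by (intro sum.neutral ballI) simp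
qed

lemma two_sided_mult_hom:
  assumes ab: "admissible a b"
  shows "two_sided_mult a b \<in> LinearCombinations.module_hom class_ring V V"
  unfolding LinearCombinations.module_hom_def
proof (intro CollectI conjI allI impI Pi_I)
  show "x \<in> carrier V \<Longrightarrow> two_sided_mult a b x \<in> carrier V" for x by (rule two_sided_mult_closed[OF ab])
next
  fix x y assume "x \<in> carrier V \<and> y \<in> carrier V"
  hence len: "length x = m" "length y = m" and car: "\<And>k. k < m \<Longrightarrow> x ! k \<in> carrier_mat p q"
    "\<And>k. k < m \<Longrightarrow> y ! k \<in> carrier_mat p q"
    by (auto simp: tuple_space_carrier)
  show "two_sided_mult a b (x \<oplus>\<^bsub>V\<^esub> y) = two_sided_mult a b x \<oplus>\<^bsub>V\<^esub> two_sided_mult a b y"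
  proof (rule nth_equalityI)
    fix k assume "k < length (two_sided_mult a b (x \<oplus>\<^bsub>V\<^esub> y))"
    hence k: "k < m" using len by (simp add: two_sided_mult_def tuple_space_add)
    have c: "a k \<in> carrier_mat p p" "b k \<in> carrier_mat q q" using ab k by (auto simp: admissible_def)
    have "a k * (x ! k + y ! k) * b k = a k * x ! k * b k + a k * y ! k * b k"
      using c car[OF k]
      by (simp add: mult_add_distrib_mat[of _ p p _ q] add_mult_distrib_mat[of _ p q _ _ q])
    thus "two_sided_mult a b (x \<oplus>\<^bsub>V\<^esub> y) ! k = (two_sided_mult a b x \<oplus>\<^bsub>V\<^esub> two_sided_mult a b y) ! k"
      using len k by (simp add: two_sided_mult_def tuple_space_add)
  qed (use len in \<open>simp add: two_sided_mult_def tuple_space_add\<close>)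
next
  fix c :: complex and x assume "c \<in> carrier class_ring \<and> x \<in> carrier V"
  hence len: "length x = m" and car: "\<And>k. k < m \<Longrightarrow> x ! k \<in> carrier_mat p q"
    by (auto simp: tuple_space_carrier)
  show "two_sided_mult a b (c \<odot>\<^bsub>V\<^esub> x) = c \<odot>\<^bsub>V\<^esub> two_sided_mult a b x"
  proof (rule nth_equalityI)
    fix k assume "k < length (two_sided_mult a b (c \<odot>\<^bsub>V\<^esub> x))"
    hence k: "k < m" using len by (simp add: two_sided_mult_def tuple_space_smult)
    have cc: "a k \<in> carrier_mat p p" "b k \<in> carrier_mat q q" using ab k by (auto simp: admissible_def)
    have "a k * (c \<cdot>\<^sub>m x ! k) * b k = c \<cdot>\<^sub>m (a k * x ! k * b k)"
      using cc car[OF k] by (simp add: mult_smult_distrib[of _ p p _ q] mult_smult_assoc_mat[of _ p q _ q])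
    thus "two_sided_mult a b (c \<odot>\<^bsub>V\<^esub> x) ! k = (c \<odot>\<^bsub>V\<^esub> two_sided_mult a b x) ! k"
      using len k by (simp add: two_sided_mult_def tuple_space_smult)
  qed (use len in \<open>simp add: two_sided_mult_def tuple_space_smult\<close>)
qed

lemma two_sided_mult_comp:
  assumes "admissible a b" and "admissible a' b'" and "x \<in> carrier V"
  shows "two_sided_mult a b (two_sided_mult a' b' x) = two_sided_mult (\<lambda>k. a k * a' k) (\<lambda>k. b' k * b k) x"
proof (rule nth_equalityI)
  fix k assume "k < length (two_sided_mult a b (two_sided_mult a' b' x))"
  hence k: "k < m" using assms by (simp add: two_sided_mult_def tuple_space_carrier)
  have c: "a k \<in> carrier_mat p p" "a' k \<in> carrier_mat p p" "b k \<in> carrier_mat q q" "b' k \<in> carrier_mat q q"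
    "x ! k \<in> carrier_mat p q"
    using assms k by (auto simp: admissible_def tuple_space_carrier)
  have "a k * (a' k * x ! k * b' k) * b k = a k * a' k * x ! k * (b' k * b k)"
    using c by (simp add: assoc_mult_mat[of _ p p _ p _ q] assoc_mult_mat[of _ p p _ q _ q]
        assoc_mult_mat[of _ p q _ q _ q] mult_carrier_mat[of _ p p _ q] mult_carrier_mat[of _ p q _ q])
  thus "two_sided_mult a b (two_sided_mult a' b' x) ! k
      = two_sided_mult (\<lambda>k. a k * a' k) (\<lambda>k. b' k * b k) x ! k"
    using k assms by (simp add: two_sided_mult_def tuple_space_carrier)
qed (simp add: two_sided_mult_def)

lemma two_sided_mult_cong:
  assumes "\<And>k. k < m \<Longrightarrow> a k = a' k" and "\<And>k. k < m \<Longrightarrow> b k = b' k" and "x \<in> carrier V"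
  shows "two_sided_mult a b x = two_sided_mult a' b' x"
  using assms by (auto simp: two_sided_mult_def tuple_space_carrier)

text \<open>In the basis of matrix units, the coefficient of the unit at (i, j) in the image of the
  unit at (i', j') of the same block is the entry (i, i') of a times the entry (j', j) of b. This
  matrix is triangular in a suitable order, with the asserted factors on its diagonal.\<close>

lemma det_two_sided_mult_triangular:
  assumes bs: "ordered_basis V bs" and ab: "admissible a b"
    and tri: "\<And>k. k < m \<Longrightarrow> upper_triangular (a k) \<and> upper_triangular (b k)"
  shows "Determinant.det (matrix_wrt (two_sided_mult a b) bs V bs)
    = (\<Prod>(k, i, j)\<in>D. a k $$ (i, i) * b k $$ (j, j))"
proof -
  have "finite D" using D_subset by (rule finite_subset) auto
  then obtain ts where ts: "set ts = D" "distinct ts" using finite_distinct_list by blast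
  define es where "es = map (unit_tuple p q m) ts"
  have es: "ordered_basis V es" unfolding es_def by (rule unit_tuples_basis[OF D_subset ts])
  let ?A = "matrix_wrt (two_sided_mult a b) es V es"
  let ?n = "length ts"
  \<comment> \<open>The two triangularity conditions i \<le> i' and j' \<le> j push i - j in the
    same direction, and equality of ranks forces equal positions. One integer rank thus replaces an
    explicit reordering of \<open>ts\<close>.\<close>
  define rk where "rk l = (case ts ! l of (k, i, j) \<Rightarrow> int i - int j)" for l
  have A: "?A = mat ?n ?n (\<lambda>(l, l'). case ts ! l of (k, i, j) \<Rightarrow> two_sided_mult a b (es ! l') ! k $$ (i, j))"
  proof -
    have "two_sided_mult a b \<in> set es \<rightarrow> carrier V"
      using two_sided_mult_closed[OF ab] ordered_basis_subset[OF tuple_space_vectorspace es] by auto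
    from matrix_wrt_unit_tuples[OF D_subset ts this] show ?thesis by (simp add: es_def)
  qed
  have entry: "?A $$ (l, l') = (if k = k' then a k $$ (i, i') * b k $$ (j', j) else 0)"
    if l: "l < ?n" "l' < ?n" and t: "ts ! l = (k, i, j)" "ts ! l' = (k', i', j')" for l l' k i j k' i' j'
  proof -
    have r: "k < m" "i < p" "j < q" "k' < m" "i' < p" "j' < q"
      using l t ts D_subset nth_mem[of l ts] nth_mem[of l' ts] by auto
    have car: "a k \<in> carrier_mat p p" "unit_tuple p q m (k', i', j') ! k \<in> carrier_mat p q"
      "b k \<in> carrier_mat q q"
      using ab r by (auto simp: admissible_def unit_tuple_def)
    have len: "length (unit_tuple p q m (k', i', j')) = m" by (simp add: unit_tuple_def)
    have "?A $$ (l, l') = two_sided_mult a b (es ! l') ! k $$ (i, j)"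
      by (subst A) (use l t in simp)
    also have "es ! l' = unit_tuple p q m (k', i', j')" using l t by (simp add: es_def)
    also have "two_sided_mult a b (unit_tuple p q m (k', i', j')) ! k
        = a k * unit_tuple p q m (k', i', j') ! k * b k"
      using len r by (simp add: two_sided_mult_def)
    also have "(a k * unit_tuple p q m (k', i', j') ! k * b k) $$ (i, j) = (\<Sum>j''<q. (\<Sum>i''<p.
        if i'' = i' then (if k = k' \<and> j'' = j' then a k $$ (i, i') else 0) else 0) * b k $$ (j'', j))"
      unfolding mat_mult3_nth[OF car r(2,3)]
      by (intro sum.cong refl arg_cong2[where f = "(*)"]) (use r in \<open>auto simp: unit_tuple_nth\<close>)
    also have "\<dots> = (\<Sum>j''<q. if j'' = j' then (if k = k' then a k $$ (i, i') * b k $$ (j', j) else 0) else 0)"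
      using r by (intro sum.cong) auto
    also have "\<dots> = (if k = k' then a k $$ (i, i') * b k $$ (j', j) else 0)"
      using r by simp
    finally show ?thesis .
  qed
  have "Determinant.det (matrix_wrt (two_sided_mult a b) bs V bs) = Determinant.det ?A"
    by (rule det_matrix_wrt_basis_indep[OF tuple_space_vectorspace bs es two_sided_mult_hom[OF ab]])
  also have "\<dots> = (\<Prod>l<?n. ?A $$ (l, l))"
  proof (rule det_rank_triangular[where rk = rk])
    show "?A \<in> carrier_mat ?n ?n" by (simp add: A)
    fix l l' assume l: "l < ?n" "l' < ?n" and nz: "?A $$ (l, l') \<noteq> 0"
    obtain k i j k' i' j' where t: "ts ! l = (k, i, j)" "ts ! l' = (k', i', j')"
      by (cases "ts ! l", cases "ts ! l'")
    have r: "k < m" "i < p" "j < q" "k' < m" "i' < p" "j' < q"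
      using l t ts D_subset nth_mem[of l ts] nth_mem[of l' ts] by auto
    from nz entry[OF l t] have k: "k = k'" and an: "a k $$ (i, i') \<noteq> 0" and bn: "b k $$ (j', j) \<noteq> 0"
      by (auto split: if_splits)
    have car: "dim_row (a k) = p" "dim_row (b k) = q" using ab r by (auto simp: admissible_def)
    have "i \<le> i'"
      using an upper_triangularD[of "a k" i' i] tri[OF r(1)] car r by (intro leI notI) simp
    moreover have "j' \<le> j"
      using bn upper_triangularD[of "b k" j j'] tri[OF r(1)] car r k by (intro leI notI) simp
    ultimately have "ts ! l = ts ! l' \<or> rk l < rk l'" using t k by (auto simp: rk_def)
    thus "l = l' \<or> rk l < rk l'" using l ts nth_eq_iff_index_eq by blast
  qed
  also have "\<dots> = (\<Prod>l<?n. case ts ! l of (k, i, j) \<Rightarrow> a k $$ (i, i) * b k $$ (j, j))"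
    by (rule prod.cong) (auto simp: entry split: prod.splits)
  also have "\<dots> = (\<Prod>t\<in>D. case t of (k, i, j) \<Rightarrow> a k $$ (i, i) * b k $$ (j, j))"
    by (rule prod.reindex_bij_betw) (use ts in \<open>auto intro!: bij_betw_nth\<close>)
  finally show ?thesis .
qed

text \<open>On full blocks, a simultaneous Schur triangularization of the factors reduces the determinant to
  the triangular case.\<close>

lemma det_two_sided_mult:
  assumes bs: "ordered_basis V bs" and ab: "admissible a b"
  shows "Determinant.det (matrix_wrt (two_sided_mult a b) bs V bs)
    = (\<Prod>k<m. if k \<in> K then Determinant.det (a k) ^ q * Determinant.det (b k) ^ p
        else \<Prod>(i, j)\<in>D `` {k}. a k $$ (i, i) * b k $$ (j, j))"
proof -
  \<comment> \<open>This treats both kinds of blocks at once. On a full block it is a Schur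
    triangularization. On the others the matrix is already triangular and the conjugation is the
    identity, as a general conjugation would not preserve the staircase.\<close>
  define \<Phi> where "\<Phi> n A full T P Q \<longleftrightarrow> T \<in> carrier_mat n n \<and> P \<in> carrier_mat n n \<and> Q \<in> carrier_mat n n \<and>
    upper_triangular T \<and> A * P = P * T \<and> Q * A = T * Q \<and> P * Q = 1\<^sub>m n \<and> Q * P = 1\<^sub>m n \<and>
    (if full then (\<Prod>i<n. T $$ (i, i)) = Determinant.det (A :: complex mat)
     else T = A \<and> P = 1\<^sub>m n \<and> Q = 1\<^sub>m n)" for n A full T P Q
  have ex: "\<exists>T P Q. \<Phi> n A full T P Q"
    if A: "A \<in> carrier_mat n n" and tri: "\<not> full \<longrightarrow> upper_triangular A" for n A full
  proof (cases full)
    case True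
    thus ?thesis using schur_triangularization[OF A] unfolding \<Phi>_def by simp
  next
    case False
    hence "\<Phi> n A full A (1\<^sub>m n) (1\<^sub>m n)" using A tri unfolding \<Phi>_def by auto
    thus ?thesis by blast
  qed
  have "\<exists>T P Q. \<Phi> p (a k) (k \<in> K) T P Q" "\<exists>T P Q. \<Phi> q (b k) (k \<in> K) T P Q" if "k < m" for k
    using ab that unfolding admissible_def by (intro ex; blast)+
  then obtain T P Q U R S where TU: "\<And>k. k < m \<Longrightarrow> \<Phi> p (a k) (k \<in> K) (T k) (P k) (Q k)"
      "\<And>k. k < m \<Longrightarrow> \<Phi> q (b k) (k \<in> K) (U k) (R k) (S k)"
    by metis
  note T = TU(1)[unfolded \<Phi>_def] and U = TU(2)[unfolded \<Phi>_def]
  have T_tri: "upper_triangular (T k)" "upper_triangular (U k)" if "k < m" for k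
    using T[OF that] U[OF that] by blast+
  have adm: "admissible T U" "admissible P S" "admissible Q R"
  proof -
    have "T k \<in> carrier_mat p p" "P k \<in> carrier_mat p p" "Q k \<in> carrier_mat p p"
      "U k \<in> carrier_mat q q" "R k \<in> carrier_mat q q" "S k \<in> carrier_mat q q" if "k < m" for k
      using T[OF that] U[OF that] by blast+
    moreover have "P k = 1\<^sub>m p \<and> Q k = 1\<^sub>m p \<and> R k = 1\<^sub>m q \<and> S k = 1\<^sub>m q" if "k < m" "k \<notin> K" for k
      using T[OF that(1)] U[OF that(1)] that(2) by simp
    ultimately show "admissible T U" "admissible P S" "admissible Q R"
      using T_tri upper_triangular_one by (simp_all add: admissible_def)
  qed
  note V = tuple_space_vectorspace[of p q m D]
  note hom = two_sided_mult_hom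
  \<comment> \<open>On the left a P = P T is used, on the right S b = U S. The conjugating operator
    is therefore given by \<open>P\<close> and \<open>S\<close>, and its inverse by \<open>Q\<close>
    and \<open>R\<close>.\<close>
  have "two_sided_mult a b (two_sided_mult P S x) = two_sided_mult P S (two_sided_mult T U x)"
    if x: "x \<in> carrier V" for x
    unfolding two_sided_mult_comp[OF ab adm(2) x] two_sided_mult_comp[OF adm(2,1) x]
    by (rule two_sided_mult_cong[OF _ _ x]) (use T U in auto)
  from det_matrix_wrt_intertwine[OF V V bs bs hom[OF adm(1)] hom[OF ab] hom[OF adm(2)] hom[OF adm(2)] this]
  have eq: "Determinant.det (matrix_wrt (two_sided_mult a b) bs V bs)
      * Determinant.det (matrix_wrt (two_sided_mult P S) bs V bs)
    = Determinant.det (matrix_wrt (two_sided_mult P S) bs V bs)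
      * Determinant.det (matrix_wrt (two_sided_mult T U) bs V bs)" .
  have id: "two_sided_mult Q R (two_sided_mult P S x) = x" if x: "x \<in> carrier V" for x
  proof -
    have "two_sided_mult Q R (two_sided_mult P S x) = two_sided_mult (\<lambda>k. 1\<^sub>m p) (\<lambda>k. 1\<^sub>m q) x"
      unfolding two_sided_mult_comp[OF adm(3,2) x]
      by (rule two_sided_mult_cong[OF _ _ x]) (use T U in auto)
    also have "\<dots> = x"
      using x by (intro nth_equalityI) (auto simp: two_sided_mult_def tuple_space_carrier)
    finally show ?thesis .
  qed
  have "matrix_wrt (two_sided_mult Q R) bs V bs * matrix_wrt (two_sided_mult P S) bs V bs
      = matrix_wrt (\<lambda>x. two_sided_mult Q R (two_sided_mult P S x)) bs V bs"
    by (rule matrix_wrt_comp_hom[symmetric, OF V V V bs bs bs hom[OF adm(2)] hom[OF adm(3)]])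
  also have "\<dots> = matrix_wrt (\<lambda>x. x) bs V bs"
    by (rule matrix_wrt_cong) (use id ordered_basis_subset[OF V bs] in auto)
  also have "\<dots> = 1\<^sub>m (length bs)" by (rule matrix_wrt_id[OF V bs])
  finally have "Determinant.det (matrix_wrt (two_sided_mult Q R) bs V bs)
      * Determinant.det (matrix_wrt (two_sided_mult P S) bs V bs) = 1"
    using det_mult[OF matrix_wrt_carrier[OF V V bs bs hom[OF adm(3)]] matrix_wrt_carrier[OF V V bs bs hom[OF adm(2)]]]
    by simp
  hence "Determinant.det (matrix_wrt (two_sided_mult P S) bs V bs) \<noteq> 0" by auto
  with eq have "Determinant.det (matrix_wrt (two_sided_mult a b) bs V bs)
      = Determinant.det (matrix_wrt (two_sided_mult T U) bs V bs)" by simp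
  also have "\<dots> = (\<Prod>(k, i, j)\<in>D. T k $$ (i, i) * U k $$ (j, j))"
    by (rule det_two_sided_mult_triangular[OF bs adm(1)]) (simp add: T_tri)
  also have "\<dots> = (\<Prod>(k, i, j)\<in>(SIGMA k:{..<m}. D `` {k}). T k $$ (i, i) * U k $$ (j, j))"
    using D_subset by (intro prod.cong) auto
  also have "\<dots> = (\<Prod>k<m. \<Prod>(i, j)\<in>D `` {k}. T k $$ (i, i) * U k $$ (j, j))"
  proof (rule prod.Sigma[symmetric])
    show "\<forall>k\<in>{..<m}. finite (D `` {k})"
    proof
      fix k
      have "D `` {k} \<subseteq> {..<p} \<times> {..<q}" using D_subset by auto
      thus "finite (D `` {k})" by (rule finite_subset) simp
    qed
  qed simp
  also have "\<dots> = (\<Prod>k<m. if k \<in> K then Determinant.det (a k) ^ q * Determinant.det (b k) ^ p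
        else \<Prod>(i, j)\<in>D `` {k}. a k $$ (i, i) * b k $$ (j, j))"
  proof (rule prod.cong)
    fix k assume "k \<in> {..<m}"
    hence k: "k < m" by simp
    show "(\<Prod>(i, j)\<in>D `` {k}. T k $$ (i, i) * U k $$ (j, j))
      = (if k \<in> K then Determinant.det (a k) ^ q * Determinant.det (b k) ^ p
        else \<Prod>(i, j)\<in>D `` {k}. a k $$ (i, i) * b k $$ (j, j))"
    proof (cases "k \<in> K")
      case True
      have "D `` {k} = {..<p} \<times> {..<q}" using D_subset D_full[OF k True] by auto
      hence "(\<Prod>(i, j)\<in>D `` {k}. T k $$ (i, i) * U k $$ (j, j))
        = (\<Prod>i<p. \<Prod>j<q. T k $$ (i, i) * U k $$ (j, j))"
        by (simp only: prod.cartesian_product)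
      \<comment> \<open>In a full block each diagonal entry of \<open>T k\<close> occurs once per
        column and each diagonal entry of \<open>U k\<close> once per row.\<close>
      also have "\<dots> = (\<Prod>i<p. T k $$ (i, i)) ^ q * (\<Prod>j<q. U k $$ (j, j)) ^ p"
        by (simp add: prod.distrib prod_power_distrib)
      finally show ?thesis using True T[OF k] U[OF k] by simp
    next
      case False
      thus ?thesis using T[OF k] U[OF k] by simp
    qed
  qed simp
  finally show ?thesis .
qed

end

section \<open>Holomorphic functions and inverse matrices\<close>

lemma holomorphic_wrt_cong:
  assumes "\<And>x. x \<in> X \<Longrightarrow> f x = g x"
  shows "holomorphic_wrt J coord X f \<longleftrightarrow> holomorphic_wrt J coord X g"
  using assms unfolding holomorphic_wrt_def by (auto cong: ball_cong)

context
  fixes J :: "'i set" and coord :: "'a \<Rightarrow> 'i \<Rightarrow> complex" and X :: "'a set"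
  assumes J: "finite J"
begin

definition coord_dist :: "'a \<Rightarrow> 'a \<Rightarrow> real" where
  "coord_dist x y = (\<Sum>i\<in>J. cmod (coord y i - coord x i))"

text \<open>The \<epsilon>-\<delta> condition in \<open>holomorphic_wrt\<close> refers to
  coordinates and to points of \<open>X\<close> only. Pulling back the neighbourhoods of 0 along the
  distance gives a filter with this meaning, to which Landau calculus applies.\<close>

definition coord_nhds :: "'a \<Rightarrow> 'a filter" where
  "coord_nhds x = inf (filtercomap (coord_dist x) (nhds 0)) (principal X)"

lemma coord_dist_nonneg: "coord_dist x y \<ge> 0"
  by (simp add: coord_dist_def sum_nonneg)

lemma norm_coord_dist: "norm (complex_of_real (coord_dist x y)) = coord_dist x y"
  by (simp add: coord_dist_nonneg)

lemma eventually_coord_nhds: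
  "eventually P (coord_nhds x) \<longleftrightarrow> (\<exists>\<delta>>0. \<forall>y\<in>X. coord_dist x y < \<delta> \<longrightarrow> P y)"
proof
  assume "eventually P (coord_nhds x)"
  then obtain Q where Q: "eventually Q (nhds 0)" and QP: "\<And>y. Q (coord_dist x y) \<Longrightarrow> y \<in> X \<Longrightarrow> P y"
    unfolding coord_nhds_def eventually_inf_principal eventually_filtercomap by blast
  from Q obtain \<delta> where "\<delta> > 0" "\<And>t. dist t 0 < \<delta> \<Longrightarrow> Q t" unfolding eventually_nhds_metric by blast
  thus "\<exists>\<delta>>0. \<forall>y\<in>X. coord_dist x y < \<delta> \<longrightarrow> P y"
    using QP coord_dist_nonneg by (intro exI[of _ \<delta>]) (auto simp: dist_real_def)
next
  assume "\<exists>\<delta>>0. \<forall>y\<in>X. coord_dist x y < \<delta> \<longrightarrow> P y"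
  then obtain \<delta> where d: "\<delta> > 0" "\<And>y. y \<in> X \<Longrightarrow> coord_dist x y < \<delta> \<Longrightarrow> P y" by blast
  have "eventually (\<lambda>t. t \<in> {..<\<delta>}) (nhds 0)" by (rule eventually_nhds_in_open) (use d(1) in auto)
  thus "eventually P (coord_nhds x)"
    unfolding coord_nhds_def eventually_inf_principal eventually_filtercomap using d(2) by blast
qed

definition coord_linear :: "('i \<Rightarrow> complex) \<Rightarrow> 'a \<Rightarrow> 'a \<Rightarrow> complex" where
  "coord_linear c x y = (\<Sum>i\<in>J. c i * (coord y i - coord x i))"

text \<open>The distance is cast to the complex numbers because both sides of a Landau symbol take
  values in the same field.\<close>

definition has_deriv_wrt :: "('a \<Rightarrow> complex) \<Rightarrow> ('i \<Rightarrow> complex) \<Rightarrow> 'a \<Rightarrow> bool" where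
  "has_deriv_wrt f c x \<longleftrightarrow> (\<lambda>y. f y - f x - coord_linear c x y)
    \<in> o[coord_nhds x](\<lambda>y. complex_of_real (coord_dist x y))"

lemma holomorphic_wrt_iff:
  "holomorphic_wrt J coord X f \<longleftrightarrow> (\<forall>x\<in>X. \<exists>c. has_deriv_wrt f c x)"
  unfolding holomorphic_wrt_def has_deriv_wrt_def smallo_def eventually_coord_nhds coord_linear_def
    norm_coord_dist mem_Collect_eq
  unfolding coord_dist_def by (rule refl)

lemma coord_linear_bigo:
  "coord_linear c x \<in> O[F](\<lambda>y. complex_of_real (coord_dist x y))"
proof (rule bigoI, rule always_eventually, rule allI)
  fix y
  have "cmod (coord_linear c x y) \<le> (\<Sum>i\<in>J. cmod (c i) * cmod (coord y i - coord x i))"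
    unfolding coord_linear_def by (rule order_trans[OF norm_sum]) (simp add: norm_mult)
  also have "\<dots> \<le> (\<Sum>i\<in>J. (\<Sum>j\<in>J. cmod (c j)) * cmod (coord y i - coord x i))"
    by (intro sum_mono mult_right_mono member_le_sum) (use J in auto)
  also have "\<dots> = (\<Sum>j\<in>J. cmod (c j)) * norm (complex_of_real (coord_dist x y))"
    unfolding norm_coord_dist by (simp add: coord_dist_def sum_distrib_left)
  finally show "cmod (coord_linear c x y) \<le> (\<Sum>j\<in>J. cmod (c j)) * norm (complex_of_real (coord_dist x y))" .
qed

lemma coord_dist_smallo: "(\<lambda>y. complex_of_real (coord_dist x y)) \<in> o[coord_nhds x](\<lambda>_. 1)"
proof (rule smalloI_tendsto)
  have "filterlim (coord_dist x) (nhds 0) (coord_nhds x)"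
    unfolding coord_nhds_def by (rule filterlim_mono[OF filterlim_filtercomap order_refl]) simp
  thus "((\<lambda>y. complex_of_real (coord_dist x y) / 1) \<longlongrightarrow> 0) (coord_nhds x)"
    using tendsto_of_real[of "coord_dist x" 0 "coord_nhds x"] by simp
qed simp

lemma has_deriv_wrt_bigo:
  assumes "has_deriv_wrt f c x"
  shows "(\<lambda>y. f y - f x) \<in> O[coord_nhds x](\<lambda>y. complex_of_real (coord_dist x y))"
proof -
  have "(\<lambda>y. (f y - f x - coord_linear c x y) + coord_linear c x y)
      \<in> O[coord_nhds x](\<lambda>y. complex_of_real (coord_dist x y))"
    using assms unfolding has_deriv_wrt_def
    by (intro sum_in_bigo(1)[OF landau_o.small_imp_big coord_linear_bigo])
  thus ?thesis by simp
qed

lemma has_deriv_wrt_tendsto: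
  assumes "has_deriv_wrt f c x"
  shows "(f \<longlongrightarrow> f x) (coord_nhds x)"
proof -
  have "(\<lambda>y. f y - f x) \<in> o[coord_nhds x](\<lambda>_. 1)"
    using has_deriv_wrt_bigo[OF assms] coord_dist_smallo by (rule landau_o.big_small_trans)
  hence "((\<lambda>y. f y - f x) \<longlongrightarrow> 0) (coord_nhds x)" by (auto dest: smalloD_tendsto)
  thus ?thesis by (simp add: LIM_zero_iff)
qed

text \<open>Differentiability gives continuity, so f y - f x is o(1), and o(1) times O(distance) is
  o(distance). This disposes of the second-order terms for products and for inverses.\<close>

lemma has_deriv_wrt_mult_smallo:
  assumes "has_deriv_wrt f c x" and "g \<in> O[coord_nhds x](\<lambda>y. complex_of_real (coord_dist x y))"
  shows "(\<lambda>y. (f y - f x) * g y) \<in> o[coord_nhds x](\<lambda>y. complex_of_real (coord_dist x y))"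
proof -
  have "(\<lambda>y. f y - f x) \<in> o[coord_nhds x](\<lambda>_. 1)"
    using has_deriv_wrt_bigo[OF assms(1)] coord_dist_smallo by (rule landau_o.big_small_trans)
  from landau_o.small_big_mult[OF this assms(2)] show ?thesis by simp
qed

lemma holomorphic_wrt_const: "holomorphic_wrt J coord X (\<lambda>_. a)"
  unfolding holomorphic_wrt_iff
  by (intro ballI exI[of _ "\<lambda>_. 0"]) (simp add: has_deriv_wrt_def coord_linear_def)

lemma holomorphic_wrt_coord:
  assumes "i \<in> J"
  shows "holomorphic_wrt J coord X (\<lambda>x. coord x i)"
  unfolding holomorphic_wrt_iff
proof
  fix x
  have "coord_linear (\<lambda>j. if j = i then 1 else 0) x y = coord y i - coord x i" for y
  proof -
    have "coord_linear (\<lambda>j. if j = i then 1 else 0) x y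
        = (\<Sum>j\<in>J. if j = i then coord y j - coord x j else 0)"
      unfolding coord_linear_def by (rule sum.cong) auto
    thus ?thesis using assms J by simp
  qed
  thus "\<exists>c. has_deriv_wrt (\<lambda>x. coord x i) c x"
    by (intro exI[of _ "\<lambda>j. if j = i then 1 else 0"]) (simp add: has_deriv_wrt_def)
qed

lemma holomorphic_wrt_add:
  assumes "holomorphic_wrt J coord X f" and "holomorphic_wrt J coord X g"
  shows "holomorphic_wrt J coord X (\<lambda>x. f x + g x)"
  unfolding holomorphic_wrt_iff
proof
  fix x assume "x \<in> X"
  then obtain c d where "has_deriv_wrt f c x" "has_deriv_wrt g d x"
    using assms unfolding holomorphic_wrt_iff by blast
  hence "(\<lambda>y. (f y - f x - coord_linear c x y) + (g y - g x - coord_linear d x y))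
      \<in> o[coord_nhds x](\<lambda>y. complex_of_real (coord_dist x y))"
    unfolding has_deriv_wrt_def by (rule sum_in_smallo)
  also have "(\<lambda>y. (f y - f x - coord_linear c x y) + (g y - g x - coord_linear d x y))
      = (\<lambda>y. (f y + g y) - (f x + g x) - coord_linear (\<lambda>i. c i + d i) x y)"
    by (auto simp: coord_linear_def distrib_right sum.distrib)
  finally show "\<exists>c. has_deriv_wrt (\<lambda>x. f x + g x) c x" unfolding has_deriv_wrt_def by blast
qed

lemma holomorphic_wrt_mult:
  assumes "holomorphic_wrt J coord X f" and "holomorphic_wrt J coord X g"
  shows "holomorphic_wrt J coord X (\<lambda>x. f x * g x)"
  unfolding holomorphic_wrt_iff
proof
  fix x assume "x \<in> X"
  then obtain c d where f: "has_deriv_wrt f c x" and g: "has_deriv_wrt g d x"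
    using assms unfolding holomorphic_wrt_iff by blast
  let ?o = "o[coord_nhds x](\<lambda>y. complex_of_real (coord_dist x y))"
  \<comment> \<open>The remainder of the product rule: two scaled remainders and the cross
    term.\<close>
  have "(\<lambda>y. g x * (f y - f x - coord_linear c x y) + f x * (g y - g x - coord_linear d x y)
      + (f y - f x) * (g y - g x)) \<in> ?o"
  proof (intro sum_in_smallo)
    show "(\<lambda>y. g x * (f y - f x - coord_linear c x y)) \<in> ?o"
      "(\<lambda>y. f x * (g y - g x - coord_linear d x y)) \<in> ?o"
      using f g unfolding has_deriv_wrt_def by auto
    show "(\<lambda>y. (f y - f x) * (g y - g x)) \<in> ?o"
      by (rule has_deriv_wrt_mult_smallo[OF f has_deriv_wrt_bigo[OF g]])
  qed
  also have "(\<lambda>y. g x * (f y - f x - coord_linear c x y) + f x * (g y - g x - coord_linear d x y)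
      + (f y - f x) * (g y - g x))
    = (\<lambda>y. f y * g y - f x * g x - coord_linear (\<lambda>i. g x * c i + f x * d i) x y)"
    by (auto simp: coord_linear_def algebra_simps sum.distrib sum_distrib_left sum_subtractf)
  finally show "\<exists>c. has_deriv_wrt (\<lambda>x. f x * g x) c x" unfolding has_deriv_wrt_def by blast
qed

lemma holomorphic_wrt_inverse:
  assumes "holomorphic_wrt J coord X f" and nz: "\<And>x. x \<in> X \<Longrightarrow> f x \<noteq> 0"
  shows "holomorphic_wrt J coord X (\<lambda>x. inverse (f x))"
  unfolding holomorphic_wrt_iff
proof
  fix x assume x: "x \<in> X"
  then obtain c where f: "has_deriv_wrt f c x" using assms unfolding holomorphic_wrt_iff by blast
  let ?N = "\<lambda>y. complex_of_real (coord_dist x y)"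
  \<comment> \<open>The numerator of the remainder of 1/f over the common denominator f(y) f(x)^2.
    It consists of a second-order term and a multiple of the remainder of f.\<close>
  let ?h = "\<lambda>y. (f y - f x) * coord_linear c x y - f x * (f y - f x - coord_linear c x y)"
  have "?h \<in> o[coord_nhds x](?N)"
    using f has_deriv_wrt_mult_smallo[OF f coord_linear_bigo]
    by (intro sum_in_smallo) (auto simp: has_deriv_wrt_def)
  \<comment> \<open>By continuity at \<open>x\<close> the reciprocal of the denominator converges,
    hence is bounded near \<open>x\<close>.\<close>
  moreover have "(\<lambda>y. inverse (f y * (f x)\<^sup>2)) \<in> O[coord_nhds x](\<lambda>_. 1)"
  proof (rule bigoI_tendsto)
    show "((\<lambda>y. inverse (f y * (f x)\<^sup>2) / 1) \<longlongrightarrow> inverse (f x * (f x)\<^sup>2) / 1) (coord_nhds x)"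
      using nz[OF x] by (intro tendsto_intros has_deriv_wrt_tendsto[OF f]) auto
  qed simp
  ultimately have "(\<lambda>y. ?h y * inverse (f y * (f x)\<^sup>2)) \<in> o[coord_nhds x](\<lambda>y. ?N y * 1)"
    by (rule landau_o.small_big_mult)
  \<comment> \<open>The identity needs f(y) nonzero, which is known on \<open>X\<close>. Since the
    filter is restricted to \<open>X\<close>, any radius works, here 1.\<close>
  moreover have "eventually (\<lambda>y. ?h y * inverse (f y * (f x)\<^sup>2)
      = inverse (f y) - inverse (f x) - coord_linear (\<lambda>i. - c i / (f x)\<^sup>2) x y) (coord_nhds x)"
    unfolding eventually_coord_nhds
  proof (intro exI[of _ 1] conjI ballI impI)
    fix y assume "y \<in> X"
    hence ny: "f y \<noteq> 0" by (rule nz)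
    have lin: "coord_linear (\<lambda>i. - c i / (f x)\<^sup>2) x y = - coord_linear c x y / (f x)\<^sup>2"
      by (simp add: coord_linear_def sum_divide_distrib sum_negf)
    show "?h y * inverse (f y * (f x)\<^sup>2)
      = inverse (f y) - inverse (f x) - coord_linear (\<lambda>i. - c i / (f x)\<^sup>2) x y"
      unfolding lin using ny nz[OF x] by (simp add: field_simps power2_eq_square)
  qed simp
  ultimately have "(\<lambda>y. inverse (f y) - inverse (f x) - coord_linear (\<lambda>i. - c i / (f x)\<^sup>2) x y)
      \<in> o[coord_nhds x](?N)"
    by (simp add: landau_o.small.in_cong)
  thus "\<exists>c. has_deriv_wrt (\<lambda>x. inverse (f x)) c x" unfolding has_deriv_wrt_def by blast
qed

lemma holomorphic_wrt_sum:
  assumes "\<And>a. a \<in> A \<Longrightarrow> holomorphic_wrt J coord X (f a)"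
  shows "holomorphic_wrt J coord X (\<lambda>x. \<Sum>a\<in>A. f a x)"
  using assms
proof (induction A rule: infinite_finite_induct)
  case (insert a A)
  hence "holomorphic_wrt J coord X (\<lambda>x. f a x + (\<Sum>a\<in>A. f a x))" by (intro holomorphic_wrt_add) auto
  with insert.hyps show ?case by simp
qed (simp_all add: holomorphic_wrt_const)

lemma holomorphic_wrt_prod:
  assumes "\<And>a. a \<in> A \<Longrightarrow> holomorphic_wrt J coord X (f a)"
  shows "holomorphic_wrt J coord X (\<lambda>x. \<Prod>a\<in>A. f a x)"
  using assms
proof (induction A rule: infinite_finite_induct)
  case (insert a A)
  hence "holomorphic_wrt J coord X (\<lambda>x. f a x * (\<Prod>a\<in>A. f a x))" by (intro holomorphic_wrt_mult) auto
  with insert.hyps show ?case by simp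
qed (simp_all add: holomorphic_wrt_const)

lemma holomorphic_wrt_det:
  assumes M: "\<And>x. x \<in> X \<Longrightarrow> M x \<in> carrier_mat n n"
    and entries: "\<And>i j. i < n \<Longrightarrow> j < n \<Longrightarrow> holomorphic_wrt J coord X (\<lambda>x. M x $$ (i, j))"
  shows "holomorphic_wrt J coord X (\<lambda>x. Determinant.det (M x))"
proof -
  have "holomorphic_wrt J coord X
      (\<lambda>x. \<Sum>\<pi>\<in>{\<pi>. \<pi> permutes {0..<n}}. signof \<pi> * (\<Prod>i = 0..<n. M x $$ (i, \<pi> i)))"
  proof (intro holomorphic_wrt_sum holomorphic_wrt_mult holomorphic_wrt_const holomorphic_wrt_prod entries)
    fix \<pi> i assume "\<pi> \<in> {\<pi>. \<pi> permutes {0..<n}}" "i \<in> {0..<n}"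
    thus "i < n" "\<pi> i < n" using permutes_in_image[of \<pi> "{0..<n}" i] by auto
  qed
  thus ?thesis by (subst holomorphic_wrt_cong[OF det_def'[OF M]])
qed

lemma holomorphic_wrt_mat_mult:
  assumes A: "\<And>x. x \<in> X \<Longrightarrow> A x \<in> carrier_mat l n" and B: "\<And>x. x \<in> X \<Longrightarrow> B x \<in> carrier_mat n r"
    and hA: "\<And>i j. i < l \<Longrightarrow> j < n \<Longrightarrow> holomorphic_wrt J coord X (\<lambda>x. A x $$ (i, j))"
    and hB: "\<And>i j. i < n \<Longrightarrow> j < r \<Longrightarrow> holomorphic_wrt J coord X (\<lambda>x. B x $$ (i, j))"
    and ij: "i < l" "j < r"
  shows "holomorphic_wrt J coord X (\<lambda>x. (A x * B x) $$ (i, j))"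
proof -
  have "(A x * B x) $$ (i, j) = (\<Sum>k<n. A x $$ (i, k) * B x $$ (k, j))" if "x \<in> X" for x
    using A[OF that] B[OF that] ij by (auto simp: scalar_prod_def lessThan_atLeast0 intro!: sum.cong)
  moreover have "holomorphic_wrt J coord X (\<lambda>x. \<Sum>k<n. A x $$ (i, k) * B x $$ (k, j))"
    using hA hB ij by (intro holomorphic_wrt_sum holomorphic_wrt_mult) auto
  ultimately show ?thesis by (subst holomorphic_wrt_cong) auto
qed

end

section \<open>Inverses in the general linear group\<close>

lemma GL_carrier: "g \<in> GL m \<Longrightarrow> g \<in> carrier_mat m m"
  by (simp add: GL_def)

lemma GL_iff_det: "g \<in> GL m \<longleftrightarrow> g \<in> carrier_mat m m \<and> Determinant.det g \<noteq> 0"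
proof
  assume g: "g \<in> GL m"
  hence gc: "g \<in> carrier_mat m m" by (rule GL_carrier)
  from g obtain h where "inverts_mat g h" "inverts_mat h g"
    by (auto simp: GL_def invertible_mat_def)
  hence gh: "g * h = 1\<^sub>m m" and hg: "h * g = 1\<^sub>m (dim_row h)"
    using gc by (auto simp: inverts_mat_def)
  \<comment> \<open>\<open>invertible_mat\<close> does not prescribe the shape of the inverse; the
    dimensions of the two products force it.\<close>
  have "dim_row h = m" "dim_col h = m"
    using arg_cong[OF hg, of dim_col] arg_cong[OF gh, of dim_col] gc by auto
  hence "h \<in> carrier_mat m m" by blast
  from det_mult[OF gc this] gh have "Determinant.det g * Determinant.det h = 1" by simp
  thus "g \<in> carrier_mat m m \<and> Determinant.det g \<noteq> 0" using gc by auto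
next
  assume g: "g \<in> carrier_mat m m \<and> Determinant.det g \<noteq> 0"
  hence "g \<in> Units (ring_mat TYPE(complex) m ())" by (intro det_non_zero_imp_unit) auto
  then obtain h where "h \<in> carrier_mat m m" "h * g = 1\<^sub>m m" "g * h = 1\<^sub>m m"
    by (auto simp: Units_def ring_mat_def)
  thus "g \<in> GL m" using g by (auto simp: GL_def invertible_mat_def inverts_mat_def)
qed

lemma GL_inv_mat:
  assumes g: "g \<in> GL m"
  shows "inv_mat g \<in> carrier_mat m m" and "g * inv_mat g = 1\<^sub>m m" and "inv_mat g * g = 1\<^sub>m m"
proof -
  have gc: "g \<in> carrier_mat m m" using g by (rule GL_carrier)
  have "mat_inverse g \<noteq> None"
  proof
    assume "mat_inverse g = None"
    from mat_inverse(1)[OF gc this, of "()"] have "g \<notin> Units (ring_mat TYPE(complex) m ())" .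
    moreover have "Determinant.det g \<noteq> 0" using g by (simp add: GL_iff_det)
    ultimately show False using det_non_zero_imp_unit[OF gc, where b = "()"] by blast
  qed
  then obtain B where B: "mat_inverse g = Some B" by blast
  from mat_inverse(2)[OF gc B] B
  show "inv_mat g \<in> carrier_mat m m" "g * inv_mat g = 1\<^sub>m m" "inv_mat g * g = 1\<^sub>m m"
    by (auto simp: inv_mat_def)
qed

lemma inv_mat_eqI:
  assumes g: "g \<in> GL m" and h: "h \<in> carrier_mat m m" and gh: "h * g = 1\<^sub>m m"
  shows "inv_mat g = h"
proof -
  note i = GL_inv_mat[OF g]
  have "inv_mat g = h * g * inv_mat g" using gh i by simp
  also have "\<dots> = h * (g * inv_mat g)" by (rule assoc_mult_mat[OF h GL_carrier[OF g] i(1)])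
  also have "\<dots> = h" using i h by simp
  finally show ?thesis .
qed

lemma GL_mult: "g \<in> GL m \<Longrightarrow> h \<in> GL m \<Longrightarrow> g * h \<in> GL m"
  by (auto simp: GL_iff_det det_mult)

lemma GL_inv: "g \<in> GL m \<Longrightarrow> inv_mat g \<in> GL m"
  using GL_inv_mat[of g m] det_mult[of "inv_mat g" m g] GL_carrier[of g m] by (auto simp: GL_iff_det)

lemma det_inv_mat:
  assumes "g \<in> GL m"
  shows "Determinant.det (inv_mat g) = inverse (Determinant.det g)"
proof -
  have "Determinant.det (inv_mat g) * Determinant.det g = 1"
    using GL_inv_mat[OF assms] det_mult[of "inv_mat g" m g] GL_carrier[OF assms] by simp
  thus ?thesis by (metis inverse_unique mult.commute)
qed

lemma inv_mat_mult:
  assumes g: "g \<in> GL m" and h: "h \<in> GL m"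
  shows "inv_mat (g * h) = inv_mat h * inv_mat g"
proof (rule inv_mat_eqI[OF GL_mult[OF g h]])
  note i = GL_inv_mat[OF g] GL_inv_mat[OF h] GL_carrier[OF g] GL_carrier[OF h]
  show "inv_mat h * inv_mat g \<in> carrier_mat m m" using i by simp
  have "inv_mat h * inv_mat g * (g * h) = inv_mat h * (inv_mat g * (g * h))"
    by (rule assoc_mult_mat[of _ m m _ m _ m]) (use i in auto)
  also have "inv_mat g * (g * h) = inv_mat g * g * h"
    by (rule assoc_mult_mat[of _ m m _ m _ m, symmetric]) (use i in auto)
  finally show "inv_mat h * inv_mat g * (g * h) = 1\<^sub>m m" using i by simp
qed

lemma inv_mat_inv_mat: "g \<in> GL m \<Longrightarrow> inv_mat (inv_mat g) = g"
  using GL_inv_mat[of g m] by (intro inv_mat_eqI[of _ m]) (auto simp: GL_inv GL_carrier)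

text \<open>\<open>inv_mat\<close> comes from Gauss-Jordan elimination, whose case distinctions hide
  how its entries vary. The adjugate shows them as polynomials divided by the determinant.\<close>

lemma inv_mat_adjugate:
  assumes g: "g \<in> GL m"
  shows "inv_mat g = inverse (Determinant.det g) \<cdot>\<^sub>m adj_mat g"
proof (rule inv_mat_eqI[OF g])
  note gc = GL_carrier[OF g]
  show "inverse (Determinant.det g) \<cdot>\<^sub>m adj_mat g \<in> carrier_mat m m" using adj_mat(1)[OF gc] by simp
  have "inverse (Determinant.det g) \<cdot>\<^sub>m adj_mat g * g = inverse (Determinant.det g) \<cdot>\<^sub>m (adj_mat g * g)"
    using adj_mat(1)[OF gc] gc by (intro mult_smult_assoc_mat) auto
  also have "\<dots> = 1\<^sub>m m"
    unfolding adj_mat(3)[OF gc] using g by (intro eq_matI) (auto simp: GL_iff_det)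
  finally show "inverse (Determinant.det g) \<cdot>\<^sub>m adj_mat g * g = 1\<^sub>m m" .
qed

lemma holomorphic_wrt_inv_mat:
  assumes J: "finite J" and M: "\<And>x. x \<in> X \<Longrightarrow> M x \<in> GL n"
    and entries: "\<And>i j. i < n \<Longrightarrow> j < n \<Longrightarrow> holomorphic_wrt J coord X (\<lambda>x. M x $$ (i, j))"
    and ij: "i < n" "j < n"
  shows "holomorphic_wrt J coord X (\<lambda>x. inv_mat (M x) $$ (i, j))"
proof -
  have eq: "inv_mat (M x) $$ (i, j) = inverse (Determinant.det (M x))
      * ((-1) ^ (j + i) * Determinant.det (mat_delete (M x) j i))" if "x \<in> X" for x
    using ij GL_carrier[OF M[OF that]] adj_mat(1)[OF GL_carrier[OF M[OF that]]]
    by (simp add: inv_mat_adjugate[OF M[OF that]] adj_mat_def cofactor_def)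
  have "holomorphic_wrt J coord X (\<lambda>x. inverse (Determinant.det (M x))
      * ((-1) ^ (j + i) * Determinant.det (mat_delete (M x) j i)))"
  proof (intro holomorphic_wrt_mult[OF J] holomorphic_wrt_inverse[OF J] holomorphic_wrt_const[OF J])
    show "holomorphic_wrt J coord X (\<lambda>x. Determinant.det (M x))"
      by (rule holomorphic_wrt_det[OF J GL_carrier[OF M] entries])
    show "x \<in> X \<Longrightarrow> Determinant.det (M x) \<noteq> 0" for x using M by (simp add: GL_iff_det)
    show "holomorphic_wrt J coord X (\<lambda>x. Determinant.det (mat_delete (M x) j i))"
    proof (rule holomorphic_wrt_det[OF J])
      show "mat_delete (M x) j i \<in> carrier_mat (n - 1) (n - 1)" if "x \<in> X" for x
        using GL_carrier[OF M[OF that]] by (auto simp: mat_delete_def)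
      fix i' j' assume lt: "i' < n - 1" "j' < n - 1"
      \<comment> \<open>Deleting row \<open>j\<close> and column \<open>i\<close> shifts the later
        indices by one, so entries of the minor are again entries of \<open>M x\<close>.\<close>
      let ?i = "if i' < j then i' else Suc i'" and ?j = "if j' < i then j' else Suc j'"
      have "mat_delete (M x) j i $$ (i', j') = M x $$ (?i, ?j)" if "x \<in> X" for x
        using GL_carrier[OF M[OF that]] lt by (simp add: mat_delete_def)
      moreover have "holomorphic_wrt J coord X (\<lambda>x. M x $$ (?i, ?j))"
        using lt by (intro entries) auto
      ultimately show "holomorphic_wrt J coord X (\<lambda>x. mat_delete (M x) j i $$ (i', j'))"
        by (subst holomorphic_wrt_cong) auto
    qed
  qed
  thus ?thesis using eq by (subst holomorphic_wrt_cong) auto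
qed

section \<open>Subsets, complements and flags\<close>

lemma std_flag_iff:
  "v \<in> std_flag m a \<longleftrightarrow> v \<in> carrier_vec m \<and> (\<forall>i<m. a \<le> i \<longrightarrow> v $ i = 0)"
proof -
  interpret vec_space "TYPE(complex)" m .
  have sub: "unit_vec m ` {..<b} \<subseteq> carrier_vec m" for b by auto
  show ?thesis
  proof
    assume "v \<in> std_flag m a"
    then obtain c A where A: "finite A" "A \<subseteq> unit_vec m ` {..<a}" and v: "v = lincomb c A"
      unfolding std_flag_def span_def by auto
    have Ac: "A \<subseteq> carrier_vec m" using A sub by blast
    have "v \<in> carrier_vec m" unfolding v by (rule lincomb_closed) (use Ac in auto)
    moreover have "v $ i = 0" if i: "i < m" "a \<le> i" for i
    proof -
      have "v $ i = (\<Sum>x\<in>A. c x * x $ i)" unfolding v using lincomb_index[OF i(1) Ac] .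
      also have "\<dots> = 0" using A i by (intro sum.neutral) (auto simp: unit_vec_def)
      finally show ?thesis .
    qed
    ultimately show "v \<in> carrier_vec m \<and> (\<forall>i<m. a \<le> i \<longrightarrow> v $ i = 0)" by blast
  next
    assume v: "v \<in> carrier_vec m \<and> (\<forall>i<m. a \<le> i \<longrightarrow> v $ i = 0)"
    \<comment> \<open>Unit vectors with index at least \<open>m\<close> are all zero, so the
      enumeration is injective only after this cut-off.\<close>
    let ?b = "min a m"
    let ?S = "unit_vec m ` {..<?b} :: complex vec set"
    let ?c = "\<lambda>x. v \<bullet> x"
    have inj: "inj_on (unit_vec m :: nat \<Rightarrow> complex vec) {..<?b}"
      by (rule inj_onI) (auto simp: unit_vec_eq)
    have "lincomb ?c ?S = v"
    proof (rule eq_vecI)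
      have cl: "lincomb ?c ?S \<in> carrier_vec m" by (rule lincomb_closed) (use sub in auto)
      show "dim_vec (lincomb ?c ?S) = dim_vec v" using cl v by auto
      fix i assume "i < dim_vec v"
      hence i: "i < m" using v by auto
      have "lincomb ?c ?S $ i = (\<Sum>x\<in>?S. ?c x * x $ i)" by (rule lincomb_index[OF i sub])
      also have "\<dots> = (\<Sum>b<?b. ?c (unit_vec m b) * unit_vec m b $ i)"
        by (simp add: sum.reindex[OF inj])
      also have "\<dots> = (\<Sum>b<?b. if b = i then v $ i else 0)"
        using v i by (intro sum.cong) auto
      also have "\<dots> = v $ i" using v i by auto
      finally show "lincomb ?c ?S $ i = v $ i" .
    qed
    moreover have "lincomb ?c ?S \<in> span (unit_vec m ` {..<a})"
      unfolding span_def by (intro CollectI exI[of _ ?c] exI[of _ ?S]) auto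
    ultimately show "v \<in> std_flag m a" unfolding std_flag_def by simp
  qed
qed

section \<open>Counting elements of a subset and of its complement\<close>

lemma elt_in: "j < card I \<Longrightarrow> elt I (Suc j) \<in> I"
  unfolding elt_def by (metis card.infinite diff_Suc_1 length_sorted_list_of_set not_less0 nth_mem
      set_sorted_list_of_set)

lemma elt_less: "j < j' \<Longrightarrow> j' < card I \<Longrightarrow> elt I (Suc j) < elt I (Suc j')"
  unfolding elt_def using sorted_wrt_nth_less[OF strict_sorted_list_of_set, of j j' I] by simp

lemma elt_image: "finite I \<Longrightarrow> (\<lambda>j. elt I (Suc j)) ` {..<card I} = I"
proof (intro equalityI subsetI)
  fix x assume "finite I" "x \<in> I"
  hence "x \<in> set (sorted_list_of_set I)" by simp
  then obtain j where "j < card I" "x = sorted_list_of_set I ! j" by (auto simp: in_set_conv_nth)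
  thus "x \<in> (\<lambda>j. elt I (Suc j)) ` {..<card I}" by (auto simp: elt_def)
qed (auto simp: elt_in)

lemma elt_less_iff: "j < card I \<Longrightarrow> j' < card I \<Longrightarrow> elt I (Suc j) < elt I (Suc j') \<longleftrightarrow> j < j'"
  using elt_less[of j j' I] elt_less[of j' j I] by (cases j j' rule: linorder_cases) auto

lemma card_below_elt:
  assumes I: "finite I" and j: "j < card I"
  shows "card {x \<in> I. x < elt I (Suc j)} = j"
proof -
  have "{x \<in> I. x < elt I (Suc j)} = (\<lambda>j. elt I (Suc j)) ` {..<j}"
  proof (intro equalityI subsetI)
    fix x assume "x \<in> {x \<in> I. x < elt I (Suc j)}"
    then obtain j' where "j' < card I" "x = elt I (Suc j')" "x < elt I (Suc j)"
      using elt_image[OF I] by blast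
    thus "x \<in> (\<lambda>j. elt I (Suc j)) ` {..<j}" using elt_less_iff j by auto
  next
    fix x assume "x \<in> (\<lambda>j. elt I (Suc j)) ` {..<j}"
    thus "x \<in> {x \<in> I. x < elt I (Suc j)}" using j by (auto simp: elt_less elt_in)
  qed
  moreover have "inj_on (\<lambda>j. elt I (Suc j)) {..<j}"
    by (rule inj_onI) (use j elt_less in \<open>metis lessThan_iff less_trans nat_neq_iff\<close>)
  ultimately show ?thesis by (simp add: card_image)
qed

text \<open>The numbers from 1 up to but excluding I(a) consist of a - 1 elements of
  \<open>I\<close> and of elements of the complement. Hence I(a) - a counts complement elements
  below I(a): the subtraction of naturals loses nothing, the difference increases weakly with a, and
  it is at most the size of the complement.\<close>

lemma elt_minus_index:
  assumes I: "I \<subseteq> {1..n}" and j: "j < card I"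
  shows "elt I (Suc j) = Suc j + card {x \<in> {1..n} - I. x < elt I (Suc j)}"
proof -
  have fin: "finite I" using I finite_subset by blast
  let ?e = "elt I (Suc j)"
  have e: "?e \<in> {1..n}" using elt_in[OF j] I by auto
  have "{1..<?e} = {x \<in> I. x < ?e} \<union> {x \<in> {1..n} - I. x < ?e}" using e I by auto
  hence "card {1..<?e} = card {x \<in> I. x < ?e} + card {x \<in> {1..n} - I. x < ?e}"
    using fin by (simp only:) (rule card_Un_disjoint; auto)
  thus ?thesis using card_below_elt[OF fin j] e by auto
qed

lemma card_complement: "I \<subseteq> {1..n} \<Longrightarrow> card ({1..n} - I) = n - card I" for n :: nat
  by (subst card_Diff_subset) (auto intro: finite_subset)

lemma elt_minus_index_mono:
  assumes I: "I \<subseteq> {1..n}" and j: "j \<le> j'" "j' < card I"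
  shows "elt I (Suc j) - Suc j \<le> elt I (Suc j') - Suc j'"
proof -
  have "elt I (Suc j) \<le> elt I (Suc j')" using elt_less[of j j' I] j by (cases "j = j'") auto
  hence "card {x \<in> {1..n} - I. x < elt I (Suc j)} \<le> card {x \<in> {1..n} - I. x < elt I (Suc j')}"
    by (intro card_mono) auto
  thus ?thesis using elt_minus_index[OF I, of j] elt_minus_index[OF I, of j'] j by simp
qed

lemma elt_minus_index_le:
  assumes I: "I \<subseteq> {1..n}" and j: "j < card I"
  shows "elt I (Suc j) - Suc j \<le> n - card I"
proof -
  have "card {x \<in> {1..n} - I. x < elt I (Suc j)} \<le> card ({1..n} - I)" by (intro card_mono) auto
  thus ?thesis using elt_minus_index[OF I j] card_complement[OF I] by simp
qed

text \<open>In the \<open>(n - card I) \<times> card I\<close> rectangle, the boxes outside the diagram of \<open>I\<close> form the diagram of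
  the complement, with rows and columns exchanged.\<close>

lemma elt_complement_minus_index:
  assumes I: "I \<subseteq> {1..n}" and i: "i < n - card I"
  shows "elt ({1..n} - I) (Suc i) = Suc i + card {j. j < card I \<and> elt I (Suc j) - Suc j \<le> i}"
proof -
  let ?C = "{1..n} - I"
  let ?y = "elt ?C (Suc i)"
  have fin: "finite I" using I finite_subset by blast
  have iC: "i < card ?C" using i card_complement[OF I] by simp
  have yC: "?y \<in> ?C" by (rule elt_in[OF iC])
  have cy: "card {x \<in> ?C. x < ?y} = i" by (rule card_below_elt[OF _ iC]) simp
  \<comment> \<open>Exactly \<open>i\<close> complement elements lie below \<open>?y\<close>, which
    is itself in the complement. So an element of \<open>I\<close> lies below \<open>?y\<close>
    exactly when at most \<open>i\<close> complement elements lie below that element.\<close>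
  have iff: "elt I (Suc j) < ?y \<longleftrightarrow> elt I (Suc j) - Suc j \<le> i" if j: "j < card I" for j
  proof -
    let ?e = "elt I (Suc j)"
    have d: "?e - Suc j = card {x \<in> ?C. x < ?e}" using elt_minus_index[OF I j] by simp
    show ?thesis
    proof
      assume "?e < ?y"
      hence "card {x \<in> ?C. x < ?e} \<le> card {x \<in> ?C. x < ?y}" by (intro card_mono) auto
      thus "?e - Suc j \<le> i" using cy d by simp
    next
      assume le: "?e - Suc j \<le> i"
      show "?e < ?y"
      proof (rule ccontr)
        assume "\<not> ?e < ?y"
        moreover have "?e \<noteq> ?y" using yC elt_in[OF j] by auto
        ultimately have "insert ?y {x \<in> ?C. x < ?y} \<subseteq> {x \<in> ?C. x < ?e}" using yC by auto
        hence "card (insert ?y {x \<in> ?C. x < ?y}) \<le> card {x \<in> ?C. x < ?e}" by (intro card_mono) auto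
        thus False using le cy d by simp
      qed
    qed
  qed
  have "{x \<in> I. x < ?y} = (\<lambda>j. elt I (Suc j)) ` {j. j < card I \<and> elt I (Suc j) - Suc j \<le> i}"
  proof (intro equalityI subsetI)
    fix x assume "x \<in> {x \<in> I. x < ?y}"
    then obtain j where "j < card I" "x = elt I (Suc j)" "x < ?y" using elt_image[OF fin] by blast
    thus "x \<in> (\<lambda>j. elt I (Suc j)) ` {j. j < card I \<and> elt I (Suc j) - Suc j \<le> i}" using iff by blast
  qed (use iff elt_in in blast)
  moreover have "inj_on (\<lambda>j. elt I (Suc j)) {j. j < card I \<and> elt I (Suc j) - Suc j \<le> i}"
    by (rule inj_onI) (use elt_less in \<open>metis (mono_tags, lifting) mem_Collect_eq nat_neq_iff\<close>)
  ultimately have "card {x \<in> I. x < ?y} = card {j. j < card I \<and> elt I (Suc j) - Suc j \<le> i}"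
    by (simp add: card_image)
  moreover have "{1..n} - ?C = I" using I by auto
  ultimately show ?thesis using elt_minus_index[of ?C n i] iC by simp
qed

text \<open>Testing on the last basis vector of each flag step forces the zeros in that column.
  Conversely, a vector of F(a) meets only the first a columns, and by monotonicity none of them is
  higher than I(a) - a.\<close>

lemma Hom_flag_eq:
  assumes I: "I \<subseteq> {1..n}" and r: "card I = r"
  shows "Hom_flag n r I = supp_mats (n - r) r {(i, j). i < elt I (Suc j) - Suc j}"
proof (intro equalityI subsetI)
  fix \<phi> assume h: "\<phi> \<in> Hom_flag n r I"
  hence car: "\<phi> \<in> carrier_mat (n - r) r" by (simp add: Hom_flag_def)
  have "\<phi> $$ (i, j) = 0" if i: "i < n - r" and j: "j < r" and ge: "elt I (Suc j) - Suc j \<le> i" for i j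
  proof -
    have "unit_vec r j \<in> std_flag r (Suc j)" by (auto simp: std_flag_iff)
    moreover have "\<forall>a\<in>{1..r}. \<forall>v\<in>std_flag r a. \<phi> *\<^sub>v v \<in> std_flag (n - r) (elt I a - a)"
      using h by (simp add: Hom_flag_def image_subset_iff)
    moreover have "Suc j \<in> {1..r}" using j by simp
    ultimately have "\<phi> *\<^sub>v unit_vec r j \<in> std_flag (n - r) (elt I (Suc j) - Suc j)" by blast
    hence "(\<phi> *\<^sub>v unit_vec r j) $ i = 0" using i ge by (auto simp: std_flag_iff)
    thus ?thesis using car i j by simp
  qed
  thus "\<phi> \<in> supp_mats (n - r) r {(i, j). i < elt I (Suc j) - Suc j}"
    using car by (auto simp: supp_mats_def)
next
  fix \<phi> assume s: "\<phi> \<in> supp_mats (n - r) r {(i, j). i < elt I (Suc j) - Suc j}"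
  hence car: "\<phi> \<in> carrier_mat (n - r) r" by (simp add: supp_mats_def)
  have "\<phi> *\<^sub>v v \<in> std_flag (n - r) (elt I a - a)" if a: "a \<in> {1..r}" and v: "v \<in> std_flag r a" for a v
    unfolding std_flag_iff
  proof (intro conjI allI impI)
    have vc: "v \<in> carrier_vec r" and v0: "\<And>j. j < r \<Longrightarrow> a \<le> j \<Longrightarrow> v $ j = 0"
      using v by (auto simp: std_flag_iff)
    show "\<phi> *\<^sub>v v \<in> carrier_vec (n - r)" using car vc by simp
    fix i assume i: "i < n - r" "elt I a - a \<le> i"
    have "\<phi> $$ (i, j) * v $ j = 0" if j: "j < r" for j
    proof (cases "a \<le> j")
      case True thus ?thesis using v0 j by simp
    next
      case False
      have "elt I (Suc j) - Suc j \<le> elt I (Suc (a - 1)) - Suc (a - 1)"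
        using a False r by (intro elt_minus_index_mono[OF I]) auto
      hence "elt I (Suc j) - Suc j \<le> i" using i a by simp
      thus ?thesis using s i j by (auto simp: supp_mats_def)
    qed
    thus "(\<phi> *\<^sub>v v) $ i = 0" using car vc i by (auto simp: scalar_prod_def intro!: sum.neutral)
  qed
  thus "\<phi> \<in> Hom_flag n r I" using car by (auto simp: Hom_flag_def)
qed

section \<open>The determinant function\<close>

text \<open>\<open>dom_index\<close> and \<open>cod_index\<close> consist of the positions \<open>(k, i, j)\<close> at which the \<open>k\<close>-th matrix
  of a tuple may have a nonzero \<open>(i, j)\<close> entry. Matrix indices start at 0, whereas the arguments of
  \<open>elt\<close> start at 1.\<close>

definition dom_index :: "nat \<Rightarrow> nat \<Rightarrow> nat set list \<Rightarrow> (nat \<times> nat \<times> nat) set" where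
  "dom_index n r Is = {(k, i, j). k \<le> length Is \<and> i < n - r \<and> j < r \<and>
     (k = 0 \<or> i < elt (Is ! (k - 1)) (Suc j) - Suc j)}"

definition cod_index :: "nat \<Rightarrow> nat \<Rightarrow> nat \<Rightarrow> (nat \<times> nat \<times> nat) set" where
  "cod_index n r s = {..<s} \<times> {..<n - r} \<times> {..<r}"

lemma Subsets_nth:
  assumes "Is \<in> Subsets r n s" and "k < s"
  shows "Is ! k \<subseteq> {1..n}" and "card (Is ! k) = r"
  using assms by (auto simp: Subsets_def)

lemma supp_mats_cong:
  "(\<And>i j. i < p \<Longrightarrow> j < q \<Longrightarrow> (i, j) \<in> D \<longleftrightarrow> (i, j) \<in> D') \<Longrightarrow> supp_mats p q D = supp_mats p q D'"
  by (auto simp: supp_mats_def)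

lemma supp_mats_full:
  "(\<And>i j. i < p \<Longrightarrow> j < q \<Longrightarrow> (i, j) \<in> D) \<Longrightarrow> supp_mats p q D = carrier_mat p q"
  by (auto simp: supp_mats_def)

lemma Delta_dom_eq:
  assumes Is: "Is \<in> Subsets r n s"
  shows "Delta_dom n r Is = tuple_space (n - r) r (Suc s) (dom_index n r Is)"
proof -
  have len: "length Is = s" using Is by (simp add: Subsets_def)
  have "carrier_mat (n - r) r # map (Hom_flag n r) Is
    = map (\<lambda>k. supp_mats (n - r) r (dom_index n r Is `` {k})) [0..<Suc s]"
  proof (rule nth_equalityI)
    fix k assume "k < length (carrier_mat (n - r) r # map (Hom_flag n r) Is)"
    hence k: "k \<le> s" using len by simp
    have "(carrier_mat (n - r) r # map (Hom_flag n r) Is) ! k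
      = supp_mats (n - r) r (dom_index n r Is `` {k})"
    proof (cases k)
      case 0
      thus ?thesis by (simp, intro supp_mats_full[symmetric]) (auto simp: dom_index_def)
    next
      case (Suc l)
      hence l: "l < s" using k by simp
      have "supp_mats (n - r) r (dom_index n r Is `` {k})
        = supp_mats (n - r) r {(i, j). i < elt (Is ! l) (Suc j) - Suc j}"
        by (rule supp_mats_cong) (use Suc l len in \<open>auto simp: dom_index_def\<close>)
      thus ?thesis using Suc l len Hom_flag_eq[OF Subsets_nth[OF Is l]] by simp
    qed
    thus "(carrier_mat (n - r) r # map (Hom_flag n r) Is) ! k
      = map (\<lambda>k. supp_mats (n - r) r (dom_index n r Is `` {k})) [0..<Suc s] ! k"
      using k by (simp del: upt_Suc)
  qed (simp add: len)
  thus ?thesis by (simp only: Delta_dom_def tuple_space_def)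
qed

lemma Delta_cod_eq: "Delta_cod n r s = tuple_space (n - r) r s (cod_index n r s)"
proof -
  have "replicate s (carrier_mat (n - r) r)
    = map (\<lambda>k. supp_mats (n - r) r (cod_index n r s `` {k})) [0..<s]"
    by (rule nth_equalityI) (auto simp: cod_index_def intro!: supp_mats_full[symmetric])
  thus ?thesis by (simp add: Delta_cod_def tuple_space_def)
qed

text \<open>The staircase condition is the weak monotonicity of the column heights I(a) - a. Block 0
  holds the unrestricted \<zeta>.\<close>

lemma dom_staircase:
  assumes Is: "Is \<in> Subsets r n s"
  shows "staircase (n - r) r (Suc s) (dom_index n r Is) {0}"
proof
  have len: "length Is = s" using Is by (simp add: Subsets_def)
  show "dom_index n r Is \<subseteq> {..<Suc s} \<times> {..<n - r} \<times> {..<r}"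
    using len by (auto simp: dom_index_def)
  show "(k, i, j) \<in> dom_index n r Is" if "k \<in> {0}" "i < n - r" "j < r" for k i j
    using that by (simp add: dom_index_def)
  fix k i' j' i j
  assume D: "(k, i', j') \<in> dom_index n r Is" and le: "i \<le> i'" "j' \<le> j" "j < r"
  show "(k, i, j) \<in> dom_index n r Is"
  proof (cases "k = 0")
    case True
    thus ?thesis using D le by (auto simp: dom_index_def)
  next
    case False
    hence k: "k - 1 < s" using D len by (auto simp: dom_index_def)
    have "elt (Is ! (k - 1)) (Suc j') - Suc j' \<le> elt (Is ! (k - 1)) (Suc j) - Suc j"
      using le Subsets_nth[OF Is k] by (intro elt_minus_index_mono) auto
    thus ?thesis using D le False by (auto simp: dom_index_def)
  qed
qed

lemma cod_staircase: "staircase (n - r) r s (cod_index n r s) {..<s}"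
  by unfold_locales (auto simp: cod_index_def)

section \<open>Linearity of \<Delta> and its transformation rule\<close>

locale det_setup =
  fixes n r s :: nat and Is :: "nat set list" and bs cs :: "complex mat list list"
  assumes Is: "Is \<in> Subsets r n s"
    and bs: "ordered_basis (Delta_dom n r Is) bs"
    and cs: "ordered_basis (Delta_cod n r s) cs"
begin

abbreviation "p \<equiv> n - r"

definition groups :: "(complex mat list \<times> complex mat list) set" where
  "groups = {(gs, hs). length gs = s \<and> length hs = s \<and> set gs \<subseteq> GL r \<and> set hs \<subseteq> GL p}"

lemma groups_nth:
  assumes "(gs, hs) \<in> groups" and "k < s"
  shows "gs ! k \<in> GL r" and "hs ! k \<in> GL p" and "length gs = s" and "length hs = s"
  using assms by (auto simp: groups_def)

lemma groups_carrier:
  assumes "(gs, hs) \<in> groups" and "k < s"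
  shows "gs ! k \<in> carrier_mat r r" and "hs ! k \<in> carrier_mat p p" and "inv_mat (gs ! k) \<in> carrier_mat r r"
  using groups_nth[OF assms] GL_carrier GL_inv_mat(1) by auto

lemma groups_update:
  assumes "(gs, hs) \<in> groups"
  shows "g \<in> GL r \<Longrightarrow> (gs[k := g], hs) \<in> groups" and "h \<in> GL p \<Longrightarrow> (gs, hs[k := h]) \<in> groups"
  using assms by (auto simp: groups_def dest!: set_update_subset_insert[THEN subsetD])

lemma length_Is: "length Is = s"
  using Is by (simp add: Subsets_def)

lemma dom_space: "vectorspace class_ring (Delta_dom n r Is)"
  by (simp add: Delta_dom_eq[OF Is] tuple_space_vectorspace)

lemma cod_space: "vectorspace class_ring (Delta_cod n r s)"
  by (simp add: Delta_cod_eq tuple_space_vectorspace)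

lemma dom_carrier:
  assumes "x \<in> carrier (Delta_dom n r Is)"
  shows "length x = Suc s" and "k \<le> s \<Longrightarrow> x ! k \<in> carrier_mat p r"
  using assms by (auto simp: Delta_dom_eq[OF Is] tuple_space_carrier)

lemma cod_carrier:
  "y \<in> carrier (Delta_cod n r s) \<longleftrightarrow> length y = s \<and> (\<forall>k<s. y ! k \<in> carrier_mat p r)"
  by (auto simp: Delta_cod_eq tuple_space_carrier cod_index_def)

lemma Delta_nth: "k < length gs \<Longrightarrow> Delta gs hs x ! k = x ! 0 + hs ! k * x ! Suc k * inv_mat (gs ! k)"
  by (simp add: Delta_def)

lemma Delta_hom:
  assumes gh: "(gs, hs) \<in> groups"
  shows "Delta gs hs \<in> LinearCombinations.module_hom class_ring (Delta_dom n r Is) (Delta_cod n r s)"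
  unfolding LinearCombinations.module_hom_def
proof (intro CollectI conjI allI impI Pi_I)
  have len: "length gs = s" using gh by (simp add: groups_def)
  note car = groups_carrier[OF gh]
  {
    fix x assume x: "x \<in> carrier (Delta_dom n r Is)"
    show "Delta gs hs x \<in> carrier (Delta_cod n r s)"
      unfolding cod_carrier
    proof (intro conjI allI impI)
      show "length (Delta gs hs x) = s" using len by (simp add: Delta_def)
      fix k assume k: "k < s"
      have "hs ! k * x ! Suc k * inv_mat (gs ! k) \<in> carrier_mat p r"
        using car[OF k] dom_carrier(2)[OF x, of "Suc k"] k by auto
      thus "Delta gs hs x ! k \<in> carrier_mat p r" using k len by (simp add: Delta_nth)
    qed
  }
  {
    fix x y assume "x \<in> carrier (Delta_dom n r Is) \<and> y \<in> carrier (Delta_dom n r Is)"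
    hence lx: "length x = Suc s" and ly: "length y = Suc s"
      and cx: "\<And>k. k \<le> s \<Longrightarrow> x ! k \<in> carrier_mat p r" and cy: "\<And>k. k \<le> s \<Longrightarrow> y ! k \<in> carrier_mat p r"
      using dom_carrier by blast+
    show "Delta gs hs (x \<oplus>\<^bsub>Delta_dom n r Is\<^esub> y) = Delta gs hs x \<oplus>\<^bsub>Delta_cod n r s\<^esub> Delta gs hs y"
    proof (rule nth_equalityI)
      fix k assume "k < length (Delta gs hs (x \<oplus>\<^bsub>Delta_dom n r Is\<^esub> y))"
      hence k: "k < s" using len by (simp add: Delta_def)
      let ?h = "hs ! k" and ?g = "inv_mat (gs ! k)"
      have c: "x ! 0 \<in> carrier_mat p r" "y ! 0 \<in> carrier_mat p r" "x ! Suc k \<in> carrier_mat p r"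
        "y ! Suc k \<in> carrier_mat p r" "?h \<in> carrier_mat p p" "?g \<in> carrier_mat r r"
        using cx[of 0] cy[of 0] cx[of "Suc k"] cy[of "Suc k"] car[OF k] k by auto
      have "?h * (x ! Suc k + y ! Suc k) * ?g = ?h * x ! Suc k * ?g + ?h * y ! Suc k * ?g"
        using c by (simp add: mult_add_distrib_mat[of _ p p _ r] add_mult_distrib_mat[of _ p r _ _ r])
      moreover have "?h * x ! Suc k * ?g \<in> carrier_mat p r" "?h * y ! Suc k * ?g \<in> carrier_mat p r"
        using c by auto
      ultimately have "x ! 0 + y ! 0 + ?h * (x ! Suc k + y ! Suc k) * ?g
        = x ! 0 + ?h * x ! Suc k * ?g + (y ! 0 + ?h * y ! Suc k * ?g)"
        using c by (intro eq_matI) auto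
      thus "Delta gs hs (x \<oplus>\<^bsub>Delta_dom n r Is\<^esub> y) ! k
        = (Delta gs hs x \<oplus>\<^bsub>Delta_cod n r s\<^esub> Delta gs hs y) ! k"
        using k len lx ly
        by (simp add: Delta_dom_eq[OF Is] Delta_cod_eq tuple_space_add Delta_def)
    qed (simp add: Delta_cod_eq tuple_space_add Delta_def)
  }
  {
    fix c :: complex and x assume "c \<in> carrier class_ring \<and> x \<in> carrier (Delta_dom n r Is)"
    hence lx: "length x = Suc s" and cx: "\<And>k. k \<le> s \<Longrightarrow> x ! k \<in> carrier_mat p r"
      using dom_carrier by blast+
    show "Delta gs hs (c \<odot>\<^bsub>Delta_dom n r Is\<^esub> x) = c \<odot>\<^bsub>Delta_cod n r s\<^esub> Delta gs hs x"
    proof (rule nth_equalityI)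
      fix k assume "k < length (Delta gs hs (c \<odot>\<^bsub>Delta_dom n r Is\<^esub> x))"
      hence k: "k < s" using len by (simp add: Delta_def)
      let ?h = "hs ! k" and ?g = "inv_mat (gs ! k)"
      have cc: "x ! 0 \<in> carrier_mat p r" "x ! Suc k \<in> carrier_mat p r" "?h \<in> carrier_mat p p"
        "?g \<in> carrier_mat r r"
        using cx[of 0] cx[of "Suc k"] car[OF k] k by auto
      have "?h * (c \<cdot>\<^sub>m x ! Suc k) * ?g = c \<cdot>\<^sub>m (?h * x ! Suc k * ?g)"
        using cc by (simp add: mult_smult_distrib[of _ p p _ r] mult_smult_assoc_mat[of _ p r _ r])
      moreover have "?h * x ! Suc k * ?g \<in> carrier_mat p r" using cc by auto
      ultimately have "c \<cdot>\<^sub>m x ! 0 + ?h * (c \<cdot>\<^sub>m x ! Suc k) * ?g = c \<cdot>\<^sub>m (x ! 0 + ?h * x ! Suc k * ?g)"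
        using cc by (simp add: add_smult_distrib_left_mat[of _ p r])
      thus "Delta gs hs (c \<odot>\<^bsub>Delta_dom n r Is\<^esub> x) ! k = (c \<odot>\<^bsub>Delta_cod n r s\<^esub> Delta gs hs x) ! k"
        using k len lx by (simp add: Delta_dom_eq[OF Is] Delta_cod_eq tuple_space_smult Delta_def)
    qed (simp add: Delta_cod_eq tuple_space_smult Delta_def)
  }
qed

text \<open>Position 0 of the domain holds \<zeta>, so the group elements with index
  \<open>k\<close> belong to position \<open>Suc k\<close>. As \<zeta> enters every component, the
  factors at position 0 are the ones that come out on the codomain side.\<close>

lemma Delta_intertwine:
  assumes gh: "(gs, hs) \<in> groups" and gh': "(gs', hs') \<in> groups"
    and a: "\<And>k. k \<le> s \<Longrightarrow> a k \<in> carrier_mat p p" and b: "\<And>k. k \<le> s \<Longrightarrow> b k \<in> carrier_mat r r"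
    and ha: "\<And>k. k < s \<Longrightarrow> hs' ! k * a (Suc k) = a 0 * hs ! k"
    and bg: "\<And>k. k < s \<Longrightarrow> b (Suc k) * inv_mat (gs' ! k) = inv_mat (gs ! k) * b 0"
    and x: "x \<in> carrier (Delta_dom n r Is)"
  shows "Delta gs' hs' (two_sided_mult a b x) = two_sided_mult (\<lambda>_. a 0) (\<lambda>_. b 0) (Delta gs hs x)"
proof (rule nth_equalityI)
  have len: "length gs = s" "length gs' = s" using gh gh' by (auto simp: groups_def)
  thus "length (Delta gs' hs' (two_sided_mult a b x))
    = length (two_sided_mult (\<lambda>_. a 0) (\<lambda>_. b 0) (Delta gs hs x))"
    by (simp add: Delta_def two_sided_mult_def)
  fix k assume "k < length (Delta gs' hs' (two_sided_mult a b x))"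
  hence k: "k < s" using len by (simp add: Delta_def)
  note c = groups_carrier[OF gh k] groups_carrier[OF gh' k] a[of 0] b[of 0] a[of "Suc k"] b[of "Suc k"]
    dom_carrier(2)[OF x, of 0] dom_carrier(2)[OF x, of "Suc k"]
  let ?X = "x ! Suc k" and ?g = "inv_mat (gs ! k)" and ?g' = "inv_mat (gs' ! k)"
  have car: "hs ! k \<in> carrier_mat p p" "?g \<in> carrier_mat r r" "hs' ! k \<in> carrier_mat p p" "?g' \<in> carrier_mat r r"
    "a 0 \<in> carrier_mat p p" "b 0 \<in> carrier_mat r r" "a (Suc k) \<in> carrier_mat p p"
    "b (Suc k) \<in> carrier_mat r r" "x ! 0 \<in> carrier_mat p r" "?X \<in> carrier_mat p r"
    using c k by auto
  note assoc = assoc_mult_mat[of _ p p _ p _ r] assoc_mult_mat[of _ p p _ r _ r] assoc_mult_mat[of _ p r _ r _ r]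
  have "hs' ! k * (a (Suc k) * ?X * b (Suc k)) * ?g' = (hs' ! k * a (Suc k)) * ?X * (b (Suc k) * ?g')"
    using car by (simp add: assoc mult_carrier_mat[of _ p p _ r] mult_carrier_mat[of _ p r _ r])
  also have "\<dots> = (a 0 * hs ! k) * ?X * (?g * b 0)" by (simp only: ha[OF k] bg[OF k])
  also have "\<dots> = a 0 * (hs ! k * ?X * ?g) * b 0"
    using car by (simp add: assoc mult_carrier_mat[of _ p p _ r] mult_carrier_mat[of _ p r _ r])
  finally have eq: "hs' ! k * (a (Suc k) * ?X * b (Suc k)) * ?g' = a 0 * (hs ! k * ?X * ?g) * b 0" .
  have Y: "hs ! k * ?X * ?g \<in> carrier_mat p r" using car by auto
  have "a 0 * (x ! 0 + hs ! k * ?X * ?g) * b 0 = a 0 * x ! 0 * b 0 + a 0 * (hs ! k * ?X * ?g) * b 0"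
    using mult_add_distrib_mat[OF car(5,9) Y] add_mult_distrib_mat[of "a 0 * x ! 0" p r "a 0 * (hs ! k * ?X * ?g)" "b 0" r]
      car Y by (metis mult_carrier_mat)
  thus "Delta gs' hs' (two_sided_mult a b x) ! k
      = two_sided_mult (\<lambda>_. a 0) (\<lambda>_. b 0) (Delta gs hs x) ! k"
    using k len dom_carrier(1)[OF x] eq by (simp add: Delta_def two_sided_mult_def del: upt_Suc)
qed

text \<open>Both equivariance properties are instances of this rule, for suitable \<open>a\<close> and \<open>b\<close>.\<close>

lemma det_fun_transform:
  assumes gh: "(gs, hs) \<in> groups" and gh': "(gs', hs') \<in> groups"
    and a: "\<And>k. k \<le> s \<Longrightarrow> a k \<in> carrier_mat p p" and b: "\<And>k. k \<le> s \<Longrightarrow> b k \<in> carrier_mat r r"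
    and tri: "\<And>k. k < s \<Longrightarrow> upper_triangular (a (Suc k)) \<and> upper_triangular (b (Suc k))"
    and ha: "\<And>k. k < s \<Longrightarrow> hs' ! k * a (Suc k) = a 0 * hs ! k"
    and bg: "\<And>k. k < s \<Longrightarrow> b (Suc k) * inv_mat (gs' ! k) = inv_mat (gs ! k) * b 0"
  shows "det_fun n r bs cs (gs', hs') * (Determinant.det (a 0) ^ r * Determinant.det (b 0) ^ p *
      (\<Prod>k<s. \<Prod>(i, j)\<in>dom_index n r Is `` {Suc k}. a (Suc k) $$ (i, i) * b (Suc k) $$ (j, j)))
    = (Determinant.det (a 0) ^ r * Determinant.det (b 0) ^ p) ^ s * det_fun n r bs cs (gs, hs)"
proof -
  interpret dom: staircase p r "Suc s" "dom_index n r Is" "{0}" by (rule dom_staircase[OF Is])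
  interpret cod: staircase p r s "cod_index n r s" "{..<s}" by (rule cod_staircase)
  \<comment> \<open>The codomain and block 0 of the domain have only full blocks, so
    \<open>a 0\<close> and \<open>b 0\<close> may be arbitrary square matrices.\<close>
  have adm: "dom.admissible a b" "cod.admissible (\<lambda>_. a 0) (\<lambda>_. b 0)"
    using a b tri by (auto simp: dom.admissible_def cod.admissible_def less_Suc_eq_0_disj)
  let ?S = "two_sided_mult a b" and ?T = "two_sided_mult (\<lambda>_. a 0) (\<lambda>_. b 0)"
  have S: "Determinant.det (matrix_wrt ?S bs (Delta_dom n r Is) bs) = Determinant.det (a 0) ^ r * Determinant.det (b 0) ^ p *
      (\<Prod>k<s. \<Prod>(i, j)\<in>dom_index n r Is `` {Suc k}. a (Suc k) $$ (i, i) * b (Suc k) $$ (j, j))"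
    using dom.det_two_sided_mult[OF bs[unfolded Delta_dom_eq[OF Is]] adm(1)]
    by (simp add: Delta_dom_eq[OF Is] prod.lessThan_Suc_shift del: prod.lessThan_Suc)
  have T: "Determinant.det (matrix_wrt ?T cs (Delta_cod n r s) cs)
      = (Determinant.det (a 0) ^ r * Determinant.det (b 0) ^ p) ^ s"
    using cod.det_two_sided_mult[OF cs[unfolded Delta_cod_eq] adm(2)] by (simp add: Delta_cod_eq)
  have "Determinant.det (matrix_wrt (Delta gs' hs') bs (Delta_cod n r s) cs)
      * Determinant.det (matrix_wrt ?S bs (Delta_dom n r Is) bs)
    = Determinant.det (matrix_wrt ?T cs (Delta_cod n r s) cs)
      * Determinant.det (matrix_wrt (Delta gs hs) bs (Delta_cod n r s) cs)"
  proof (rule det_matrix_wrt_intertwine[OF dom_space cod_space bs cs Delta_hom[OF gh] Delta_hom[OF gh']])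
    show "?S \<in> LinearCombinations.module_hom class_ring (Delta_dom n r Is) (Delta_dom n r Is)"
      using dom.two_sided_mult_hom[OF adm(1)] by (simp add: Delta_dom_eq[OF Is])
    show "?T \<in> LinearCombinations.module_hom class_ring (Delta_cod n r s) (Delta_cod n r s)"
      using cod.two_sided_mult_hom[OF adm(2)] by (simp add: Delta_cod_eq)
  qed (rule Delta_intertwine[OF gh gh' a b ha bg])
  moreover have "length gs = s" "length gs' = s" using gh gh' by (auto simp: groups_def)
  ultimately show ?thesis unfolding S T by (simp add: det_fun_def)
qed

end

section \<open>Borel weights, diagonal character and holomorphy\<close>

lemma length_weight_of [simp]: "length (weight_of I) = card I"
  by (simp add: weight_of_def)

lemma weight_of_nth: "j < card I \<Longrightarrow> weight_of I ! j = int (Suc j) - int (elt I (Suc j))"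
  by (simp add: weight_of_def del: upt_Suc)

context det_setup
begin

text \<open>The determinant of right multiplication by b on H_I takes each diagonal entry of b to
  the power of its column height. It multiplies the value at the translated point, so these powers
  appear inverted in the character.\<close>

lemma det_fun_borel_right_g:
  assumes gh: "(gs, hs) \<in> groups" and k: "k < s" and b: "b \<in> borel_GL r"
  shows "det_fun n r bs cs (gs[k := gs ! k * b], hs)
    = det_fun n r bs cs (gs, hs) * borel_char (weight_of (Is ! k)) b"
proof -
  have bG: "b \<in> GL r" and bt: "upper_triangular b" using b by (auto simp: borel_GL_def)
  have bc: "b \<in> carrier_mat r r" by (rule GL_carrier[OF bG])
  have bnz: "b $$ (j, j) \<noteq> 0" if "j < r" for j
  proof -
    have "Determinant.det b = (\<Prod>j<r. b $$ (j, j))" by (rule det_upper_triangular_prod[OF bc bt])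
    thus ?thesis using bG that by (auto simp: GL_iff_det)
  qed
  note I = Subsets_nth[OF Is k]
  define gs' where "gs' = gs[k := gs ! k * b]"
  have gh': "(gs', hs) \<in> groups"
    unfolding gs'_def by (rule groups_update(1)[OF gh GL_mult[OF groups_nth(1)[OF gh k] bG]])
  \<comment> \<open>The factor at position \<open>Suc k\<close> absorbs the translation, since b (g
    b)^-1 = g^-1.\<close>
  define B where "B l = (if l = Suc k then b else 1\<^sub>m r)" for l
  have "det_fun n r bs cs (gs', hs) * (Determinant.det (1\<^sub>m p :: complex mat) ^ r * Determinant.det (B 0) ^ p *
      (\<Prod>l<s. \<Prod>(i, j)\<in>dom_index n r Is `` {Suc l}. 1\<^sub>m p $$ (i, i) * B (Suc l) $$ (j, j)))
    = (Determinant.det (1\<^sub>m p :: complex mat) ^ r * Determinant.det (B 0) ^ p) ^ s * det_fun n r bs cs (gs, hs)"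
  proof (rule det_fun_transform[OF gh gh', where a = "\<lambda>_. 1\<^sub>m p"])
    fix l assume l: "l < s"
    note c = groups_carrier[OF gh l] groups_nth[OF gh l]
    show "hs ! l * 1\<^sub>m p = 1\<^sub>m p * hs ! l" using c by simp
    show "B (Suc l) * inv_mat (gs' ! l) = inv_mat (gs ! l) * B 0"
    proof (cases "l = k")
      case True
      have "b * (inv_mat b * inv_mat (gs ! k)) = b * inv_mat b * inv_mat (gs ! k)"
        using bc GL_inv_mat(1)[OF bG] c True by (intro assoc_mult_mat[symmetric]) auto
      thus ?thesis using True c l GL_inv_mat(2)[OF bG]
        by (simp add: B_def gs'_def inv_mat_mult[OF _ bG])
    next
      case False
      thus ?thesis using c by (simp add: B_def gs'_def)
    qed
  qed (use bc bt upper_triangular_one in \<open>auto simp: B_def\<close>)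
  moreover have "(\<Prod>l<s. \<Prod>(i, j)\<in>dom_index n r Is `` {Suc l}. 1\<^sub>m p $$ (i, i) * B (Suc l) $$ (j, j))
    = (\<Prod>l<s. if l = k then \<Prod>j<r. b $$ (j, j) ^ (elt (Is ! k) (Suc j) - Suc j) else 1)"
  proof (rule prod.cong)
    fix l assume "l \<in> {..<s}"
    show "(\<Prod>(i, j)\<in>dom_index n r Is `` {Suc l}. 1\<^sub>m p $$ (i, i) * B (Suc l) $$ (j, j))
      = (if l = k then \<Prod>j<r. b $$ (j, j) ^ (elt (Is ! k) (Suc j) - Suc j) else 1)"
    proof (cases "l = k")
      case False
      thus ?thesis by (auto simp: B_def dom_index_def intro!: prod.neutral)
    next
      case True
      let ?d = "\<lambda>j. elt (Is ! k) (Suc j) - Suc j"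
      \<comment> \<open>Column heights are at most \<open>n - r\<close>, so the row bound in
        \<open>dom_index\<close> is automatic and the product can be grouped by columns.\<close>
      have "(\<Prod>(i, j)\<in>dom_index n r Is `` {Suc k}. 1\<^sub>m p $$ (i, i) * B (Suc k) $$ (j, j))
        = (\<Prod>(j, i)\<in>(SIGMA j:{..<r}. {..<?d j}). b $$ (j, j))"
        by (rule prod.reindex_bij_witness[where i = "\<lambda>(j, i). (i, j)" and j = "\<lambda>(i, j). (j, i)"])
          (use elt_minus_index_le[OF I(1)] I(2) k length_Is in \<open>force simp: dom_index_def B_def\<close>)+
      also have "\<dots> = (\<Prod>j<r. \<Prod>i<?d j. b $$ (j, j))"
        by (rule prod.Sigma[symmetric]) auto
      finally show ?thesis using True by simp
    qed
  qed simp
  moreover have "Determinant.det (B 0) = 1" by (simp add: B_def)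
  ultimately have eq: "det_fun n r bs cs (gs', hs) * (\<Prod>j<r. b $$ (j, j) ^ (elt (Is ! k) (Suc j) - Suc j))
      = det_fun n r bs cs (gs, hs)"
    using k by simp
  let ?P = "\<Prod>j<r. b $$ (j, j) ^ (elt (Is ! k) (Suc j) - Suc j)"
  have "borel_char (weight_of (Is ! k)) b = (\<Prod>j<r. inverse (b $$ (j, j) ^ (elt (Is ! k) (Suc j) - Suc j)))"
    unfolding borel_char_def
  proof (rule prod.cong)
    fix j assume "j \<in> {..<r}"
    hence j: "j < card (Is ! k)" using I(2) by simp
    \<comment> \<open>By \<open>elt_minus_index\<close> the difference of naturals is not
      truncated.\<close>
    have "weight_of (Is ! k) ! j = - int (elt (Is ! k) (Suc j) - Suc j)"
      using elt_minus_index[OF I(1) j] by (simp add: weight_of_nth[OF j])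
    thus "b $$ (j, j) powi (weight_of (Is ! k) ! j) = inverse (b $$ (j, j) ^ (elt (Is ! k) (Suc j) - Suc j))"
      by (simp only: power_int_minus power_int_of_nat)
  qed (simp add: I(2))
  also have "\<dots> = inverse ?P" by (rule prod_inversef[unfolded o_def])
  finally have "borel_char (weight_of (Is ! k)) b = inverse ?P" .
  moreover have "?P \<noteq> 0" using bnz by simp
  ultimately show ?thesis unfolding eq[symmetric] gs'_def by simp
qed

text \<open>Left multiplication by b on H_I takes each diagonal entry of b to the power of its row
  length. Row lengths and the differences for the complement add up to r, which is the origin of the
  shift.\<close>

lemma det_fun_borel_right_h:
  assumes gh: "(gs, hs) \<in> groups" and k: "k < s" and b: "b \<in> borel_GL p"
  shows "det_fun n r bs cs (gs, hs[k := hs ! k * b])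
    = det_fun n r bs cs (gs, hs) * borel_char (map (\<lambda>x. x + int r) (weight_of ({1..n} - Is ! k))) b"
proof -
  have bG: "b \<in> GL p" and bt: "upper_triangular b" using b by (auto simp: borel_GL_def)
  have bc: "b \<in> carrier_mat p p" by (rule GL_carrier[OF bG])
  note I = Subsets_nth[OF Is k]
  define hs' where "hs' = hs[k := hs ! k * b]"
  have gh': "(gs, hs') \<in> groups"
    unfolding hs'_def by (rule groups_update(2)[OF gh GL_mult[OF groups_nth(2)[OF gh k] bG]])
  define A where "A l = (if l = Suc k then b else 1\<^sub>m p)" for l
  define e where "e i = card {j. j < r \<and> i < elt (Is ! k) (Suc j) - Suc j}" for i
  have "det_fun n r bs cs (gs, hs) * (Determinant.det (A 0) ^ r * Determinant.det (1\<^sub>m r :: complex mat) ^ p *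
      (\<Prod>l<s. \<Prod>(i, j)\<in>dom_index n r Is `` {Suc l}. A (Suc l) $$ (i, i) * 1\<^sub>m r $$ (j, j)))
    = (Determinant.det (A 0) ^ r * Determinant.det (1\<^sub>m r :: complex mat) ^ p) ^ s * det_fun n r bs cs (gs, hs')"
  \<comment> \<open>The two points exchange their roles compared with the case of g: precomposing
    \<Delta> at the original point with b gives \<Delta> at the translated one.\<close>
  proof (rule det_fun_transform[OF gh' gh, where b = "\<lambda>_. 1\<^sub>m r"])
    fix l assume l: "l < s"
    have h: "hs ! l \<in> carrier_mat p p" and len: "length hs = s"
      using groups_carrier(2)[OF gh l] groups_nth(4)[OF gh l] by auto
    show "hs ! l * A (Suc l) = A 0 * hs' ! l"
    proof (cases "l = k")
      case True
      have "hs ! k * b \<in> carrier_mat p p" using h bc True by simp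
      from left_mult_one_mat[OF this] show ?thesis using True l len by (simp add: A_def hs'_def)
    next
      case False
      thus ?thesis using h by (simp add: A_def hs'_def)
    qed
    show "1\<^sub>m r * inv_mat (gs ! l) = inv_mat (gs ! l) * 1\<^sub>m r"
      using groups_carrier(3)[OF gh l] by simp
  qed (use bc bt upper_triangular_one in \<open>auto simp: A_def\<close>)
  moreover have "(\<Prod>l<s. \<Prod>(i, j)\<in>dom_index n r Is `` {Suc l}. A (Suc l) $$ (i, i) * 1\<^sub>m r $$ (j, j))
    = (\<Prod>l<s. if l = k then \<Prod>i<p. b $$ (i, i) ^ e i else 1)"
  proof (rule prod.cong)
    fix l assume "l \<in> {..<s}"
    show "(\<Prod>(i, j)\<in>dom_index n r Is `` {Suc l}. A (Suc l) $$ (i, i) * 1\<^sub>m r $$ (j, j))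
      = (if l = k then \<Prod>i<p. b $$ (i, i) ^ e i else 1)"
    proof (cases "l = k")
      case False
      thus ?thesis by (auto simp: A_def dom_index_def intro!: prod.neutral)
    next
      case True
      have "(\<Prod>(i, j)\<in>dom_index n r Is `` {Suc k}. A (Suc k) $$ (i, i) * 1\<^sub>m r $$ (j, j))
        = (\<Prod>(i, j)\<in>(SIGMA i:{..<p}. {j. j < r \<and> i < elt (Is ! k) (Suc j) - Suc j}). b $$ (i, i))"
        by (rule prod.cong) (use k length_Is in \<open>auto simp: dom_index_def A_def\<close>)
      also have "\<dots> = (\<Prod>i<p. \<Prod>j\<in>{j. j < r \<and> i < elt (Is ! k) (Suc j) - Suc j}. b $$ (i, i))"
        by (rule prod.Sigma[symmetric]) auto
      finally show ?thesis using True by (simp add: e_def)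
    qed
  qed simp
  moreover have "Determinant.det (A 0) = 1" by (simp add: A_def)
  ultimately have eq: "det_fun n r bs cs (gs, hs) * (\<Prod>i<p. b $$ (i, i) ^ e i)
      = det_fun n r bs cs (gs, hs')"
    using k by simp
  have C: "card ({1..n} - Is ! k) = p" using card_complement[OF I(1)] I(2) by simp
  \<comment> \<open>Of the r columns, \<open>e i\<close> reach beyond row \<open>i\<close>. The
    others are counted by \<open>elt_complement_minus_index\<close>.\<close>
  have weight: "int (Suc i) - int (elt ({1..n} - Is ! k) (Suc i)) + int r = int (e i)" if i: "i < p" for i
  proof -
    let ?L = "{j. j < r \<and> elt (Is ! k) (Suc j) - Suc j \<le> i}"
    let ?R = "{j. j < r \<and> i < elt (Is ! k) (Suc j) - Suc j}"
    have "card (?L \<union> ?R) = card ?L + card ?R" by (rule card_Un_disjoint) auto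
    moreover have "?L \<union> ?R = {..<r}" by auto
    ultimately have "r = card ?L + e i" by (simp add: e_def)
    moreover have "elt ({1..n} - Is ! k) (Suc i) = Suc i + card ?L"
      using elt_complement_minus_index[OF I(1)] I(2) i by simp
    ultimately show ?thesis by simp
  qed
  have "borel_char (map (\<lambda>x. x + int r) (weight_of ({1..n} - Is ! k))) b = (\<Prod>i<p. b $$ (i, i) powi int (e i))"
    unfolding borel_char_def
  proof (rule prod.cong)
    fix i assume "i \<in> {..<p}"
    hence i: "i < p" by simp
    hence iC: "i < card ({1..n} - Is ! k)" using C by simp
    have "map (\<lambda>x. x + int r) (weight_of ({1..n} - Is ! k)) ! i = int (e i)"
      using weight[OF i] iC by (simp only: weight_of_nth nth_map length_weight_of)
    thus "b $$ (i, i) powi (map (\<lambda>x. x + int r) (weight_of ({1..n} - Is ! k)) ! i) = b $$ (i, i) powi int (e i)"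
      by (simp only:)
  qed (simp only: C length_map length_weight_of)
  thus ?thesis using eq unfolding hs'_def by simp
qed

lemma det_fun_diag_action:
  assumes gh: "(gs, hs) \<in> groups" and g: "g \<in> GL r" and g': "g' \<in> GL p"
  shows "diag_action g g' (det_fun n r bs cs) (gs, hs) =
    Determinant.det g powi (int p * (int s - 1)) * Determinant.det g' powi (int r * (1 - int s)) *
    det_fun n r bs cs (gs, hs)"
proof -
  define gs' where "gs' = map (\<lambda>x. inv_mat g * x) gs"
  define hs' where "hs' = map (\<lambda>x. inv_mat g' * x) hs"
  have gh': "(gs', hs') \<in> groups"
    using gh GL_mult[OF GL_inv[OF g]] GL_mult[OF GL_inv[OF g']] by (auto simp: groups_def gs'_def hs'_def)
  \<comment> \<open>With these choices both conditions are immediate: the new h is g'^-1 h, and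
    (g^-1 g_k)^-1 = g_k^-1 g.\<close>
  define a where "a l = (if l = 0 then inv_mat g' else 1\<^sub>m p)" for l :: nat
  define b where "b l = (if l = 0 then g else 1\<^sub>m r)" for l :: nat
  have "det_fun n r bs cs (gs', hs') * (Determinant.det (a 0) ^ r * Determinant.det (b 0) ^ p *
      (\<Prod>k<s. \<Prod>(i, j)\<in>dom_index n r Is `` {Suc k}. a (Suc k) $$ (i, i) * b (Suc k) $$ (j, j)))
    = (Determinant.det (a 0) ^ r * Determinant.det (b 0) ^ p) ^ s * det_fun n r bs cs (gs, hs)"
  proof (rule det_fun_transform[OF gh gh'])
    fix l assume l: "l < s"
    note c = groups_carrier[OF gh l] groups_nth[OF gh l] groups_carrier[OF gh' l] groups_nth[OF gh' l]
    show "hs' ! l * a (Suc l) = a 0 * hs ! l"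
      using c l GL_inv_mat(1)[OF g'] by (simp add: a_def hs'_def)
    show "b (Suc l) * inv_mat (gs' ! l) = inv_mat (gs ! l) * b 0"
      using c l GL_carrier[OF g] by (simp add: b_def gs'_def inv_mat_mult[OF GL_inv[OF g]] inv_mat_inv_mat[OF g])
  qed (use GL_inv_mat(1)[OF g'] GL_carrier[OF g] upper_triangular_one in \<open>auto simp: a_def b_def\<close>)
  moreover have "(\<Prod>k<s. \<Prod>(i, j)\<in>dom_index n r Is `` {Suc k}. a (Suc k) $$ (i, i) * b (Suc k) $$ (j, j)) = 1"
    by (auto simp: a_def b_def dom_index_def intro!: prod.neutral)
  \<comment> \<open>The determinant on one full block, which occurs once in the domain and s times
    in the codomain.\<close>
  moreover define c where "c = Determinant.det (a 0) ^ r * Determinant.det (b 0) ^ p"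
  ultimately have eq: "det_fun n r bs cs (gs', hs') * c = c ^ s * det_fun n r bs cs (gs, hs)" by simp
  have nz: "Determinant.det g \<noteq> 0" "Determinant.det g' \<noteq> 0" using g g' by (auto simp: GL_iff_det)
  have c: "c = Determinant.det g powi int p * Determinant.det g' powi (- int r)"
    by (simp add: c_def a_def b_def det_inv_mat[OF g'] power_int_minus power_inverse)
  hence "c \<noteq> 0" using nz by simp
  \<comment> \<open>The integer exponent also covers s = 0, where the quotient is the inverse of
    \<open>c\<close>.\<close>
  hence "det_fun n r bs cs (gs', hs') = c powi (int s - 1) * det_fun n r bs cs (gs, hs)"
    using eq by (simp add: power_int_diff field_simps)
  also have "c powi (int s - 1) = Determinant.det g powi (int p * (int s - 1))
      * Determinant.det g' powi (- int r * (int s - 1))"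
    unfolding c power_int_mult_distrib power_int_mult by simp
  also have "- int r * (int s - 1) = int r * (1 - int s)" by (simp add: algebra_simps)
  finally show ?thesis by (simp add: diag_action_def gs'_def hs'_def)
qed

text \<open>The coordinates and the parametrization are left general because the result is needed
  for all arguments jointly and for each argument separately.\<close>

lemma det_fun_holomorphic:
  assumes J: "finite J" and gh: "\<And>x. x \<in> X \<Longrightarrow> (gs x, hs x) \<in> groups"
    and hg: "\<And>k i j. k < s \<Longrightarrow> i < r \<Longrightarrow> j < r \<Longrightarrow> holomorphic_wrt J coord X (\<lambda>x. gs x ! k $$ (i, j))"
    and hh: "\<And>k i j. k < s \<Longrightarrow> i < p \<Longrightarrow> j < p \<Longrightarrow> holomorphic_wrt J coord X (\<lambda>x. hs x ! k $$ (i, j))"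
  shows "holomorphic_wrt J coord X (\<lambda>x. det_fun n r bs cs (gs x, hs x))"
proof -
  interpret cod: staircase p r s "cod_index n r s" "{..<s}" by (rule cod_staircase)
  have "finite (cod_index n r s)" by (simp add: cod_index_def)
  then obtain ts where ts: "set ts = cod_index n r s" "distinct ts" using finite_distinct_list by blast
  define es where "es = map (unit_tuple p r s) ts"
  have es: "ordered_basis (Delta_cod n r s) es"
    unfolding es_def Delta_cod_eq by (rule unit_tuples_basis[OF cod.D_subset ts])
  let ?W = "Delta_cod n r s"
  have len: "length es = length cs" by (rule ordered_basis_length_eq[OF cod_space es cs])
  have lts: "length ts = length cs" using len by (simp add: es_def)
  \<comment> \<open>In matrix units the entries of \<Delta> are explicit. Passing from them to the
    given \<open>cs\<close> multiplies by this constant matrix and keeps entries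
    holomorphic.\<close>
  define C where "C = matrix_wrt (\<lambda>x. x) es ?W cs"
  have Cc: "C \<in> carrier_mat (length cs) (length cs)"
    using matrix_wrt_carrier[OF cod_space cod_space es cs id_module_hom] len by (simp add: C_def)
  let ?D = "\<lambda>x. Delta (gs x) (hs x)"
  let ?N = "\<lambda>x. matrix_wrt (?D x) bs ?W es"
  have dc: "bs ! l \<in> carrier (Delta_dom n r Is)" if "l < length bs" for l
    using ordered_basis_subset[OF dom_space bs] that by auto
  have Nc: "?N x \<in> carrier_mat (length cs) (length bs)" if "x \<in> X" for x
    using matrix_wrt_carrier[OF dom_space cod_space bs es Delta_hom[OF gh[OF that]]] len by simp
  have M: "matrix_wrt (?D x) bs ?W cs = C * ?N x" if "x \<in> X" for x
    using matrix_wrt_comp_hom[OF dom_space cod_space cod_space bs es cs Delta_hom[OF gh[OF that]] id_module_hom]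
    by (simp add: C_def)
  have val: "det_fun n r bs cs (gs x, hs x) = Determinant.det (C * ?N x)" if "x \<in> X" for x
    using M[OF that] gh[OF that] by (simp add: det_fun_def groups_def)
  show ?thesis
  proof (cases "length bs = length cs")
    case False
    \<comment> \<open>A non-square matrix has determinant 0 by convention, so the function is
      constant.\<close>
    have "det_fun n r bs cs (gs x, hs x) = 0" if "x \<in> X" for x
      using val[OF that] Cc Nc[OF that] False by (simp add: Determinant.det_def)
    thus ?thesis using holomorphic_wrt_const[OF J] by (subst holomorphic_wrt_cong) auto
  next
    case True
    have N_hol: "holomorphic_wrt J coord X (\<lambda>x. ?N x $$ (l, l'))" if l: "l < length cs" "l' < length bs" for l l'
    proof -
      obtain k i j where t: "ts ! l = (k, i, j)" by (cases "ts ! l")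
      have kij: "k < s" "i < p" "j < r"
        using l lts ts t nth_mem[of l ts] by (auto simp: cod_index_def)
      note bc = dom_carrier[OF dc[OF l(2)]]
      have b0: "bs ! l' ! 0 \<in> carrier_mat p r" and bk: "bs ! l' ! Suc k \<in> carrier_mat p r"
        using bc(2)[of 0] bc(2)[of "Suc k"] kij by auto
      have entry: "?N x $$ (l, l') = bs ! l' ! 0 $$ (i, j)
          + (hs x ! k * bs ! l' ! Suc k * inv_mat (gs x ! k)) $$ (i, j)" if x: "x \<in> X" for x
      proof -
        have "?D x \<in> set bs \<rightarrow> carrier ?W"
          using Delta_hom[OF gh[OF x]] ordered_basis_subset[OF dom_space bs]
          by (auto simp: LinearCombinations.module_hom_def)
        hence "?D x \<in> set bs \<rightarrow> carrier (tuple_space p r s (cod_index n r s))" by (simp add: Delta_cod_eq)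
        from matrix_wrt_unit_tuples[OF cod.D_subset ts this]
        have "?N x $$ (l, l') = ?D x (bs ! l') ! k $$ (i, j)"
          using l lts t by (simp add: es_def Delta_cod_eq)
        moreover have "dim_row (hs x ! k * bs ! l' ! Suc k * inv_mat (gs x ! k)) = p"
          "dim_col (hs x ! k * bs ! l' ! Suc k * inv_mat (gs x ! k)) = r"
          using groups_carrier[OF gh[OF x] kij(1)] by auto
        ultimately show ?thesis
          using groups_nth(3)[OF gh[OF x] kij(1)] kij by (simp add: Delta_nth)
      qed
      have "holomorphic_wrt J coord X (\<lambda>x. bs ! l' ! 0 $$ (i, j)
          + (hs x ! k * bs ! l' ! Suc k * inv_mat (gs x ! k)) $$ (i, j))"
      proof (rule holomorphic_wrt_add[OF J holomorphic_wrt_const[OF J]])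
        have hs_car: "hs x ! k \<in> carrier_mat p p" and gs_GL: "gs x ! k \<in> GL r"
          and gi_car: "inv_mat (gs x ! k) \<in> carrier_mat r r" if "x \<in> X" for x
          using groups_carrier[OF gh[OF that] kij(1)] groups_nth[OF gh[OF that] kij(1)] by auto
        show "holomorphic_wrt J coord X (\<lambda>x. (hs x ! k * bs ! l' ! Suc k * inv_mat (gs x ! k)) $$ (i, j))"
        proof (rule holomorphic_wrt_mat_mult[OF J _ gi_car _ _ kij(2,3)])
          show "hs x ! k * bs ! l' ! Suc k \<in> carrier_mat p r" if "x \<in> X" for x
            using hs_car[OF that] bk by simp
          show "holomorphic_wrt J coord X (\<lambda>x. (hs x ! k * bs ! l' ! Suc k) $$ (i, j))"
            if "i < p" "j < r" for i j
            by (rule holomorphic_wrt_mat_mult[OF J hs_car bk hh[OF kij(1)] holomorphic_wrt_const[OF J] that])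
          show "holomorphic_wrt J coord X (\<lambda>x. inv_mat (gs x ! k) $$ (i, j))" if "i < r" "j < r" for i j
            by (rule holomorphic_wrt_inv_mat[OF J gs_GL hg[OF kij(1)] that])
        qed
      qed
      thus ?thesis using entry by (subst holomorphic_wrt_cong) auto
    qed
    have "holomorphic_wrt J coord X (\<lambda>x. Determinant.det (C * ?N x))"
    proof (rule holomorphic_wrt_det[OF J])
      show "C * ?N x \<in> carrier_mat (length cs) (length cs)" if "x \<in> X" for x
        using Cc Nc[OF that] True by simp
      show "holomorphic_wrt J coord X (\<lambda>x. (C * ?N x) $$ (i, j))" if "i < length cs" "j < length cs" for i j
        by (rule holomorphic_wrt_mat_mult[OF J Cc Nc holomorphic_wrt_const[OF J] N_hol])
          (use that True in auto)
    qed
    thus ?thesis using val by (subst holomorphic_wrt_cong) auto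
  qed
qed

end

section \<open>Dual weights and membership in the tensor product\<close>

lemma dual_weight_dual_weight: "dual_weight (dual_weight w) = w"
  by (simp add: dual_weight_def rev_map[symmetric] o_def)

lemma length_dual_weight [simp]: "length (dual_weight w) = length w"
  by (simp add: dual_weight_def)

text \<open>\<open>L_BW\<close> dualizes its weight once more. The weights in the theorem are
  themselves duals, so the Borel characters are those of the original weights, with the shift by -r
  turned into +r.\<close>

lemma dual_weight_shift: "dual_weight (map (\<lambda>x. x - c) (dual_weight w)) = map (\<lambda>x. x + c) w"
  by (simp add: dual_weight_def rev_map o_def)

theorem theorem6p2p4:
  fixes n r s :: nat and Is :: "nat set list"
    and bs cs :: "complex mat list list"
  assumes "r \<in> {1..n}"
    and "Is \<in> Subsets r n s"
    and "edim n r Is = 0"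
    and "ordered_basis (Delta_dom n r Is) bs"
    and "ordered_basis (Delta_cod n r s) cs"
  shows "det_fun n r bs cs \<in>
           BW_tensor (map (\<lambda>I. (dual_weight (weight_of I),
              map (\<lambda>x. x - int r) (dual_weight (weight_of ({1..n} - I))))) Is) \<and>
         (\<forall>g \<in> GL r. \<forall>g' \<in> GL (n - r). \<forall>gs hs.
            length gs = s \<and> set gs \<subseteq> GL r \<and> length hs = s \<and> set hs \<subseteq> GL (n - r) \<longrightarrow>
            diag_action g g' (det_fun n r bs cs) (gs, hs) =
              Determinant.det g powi (int (n - r) * (int s - 1)) * Determinant.det g' powi (int r * (1 - int s)) *
              det_fun n r bs cs (gs, hs))"
proof
  interpret det_setup n r s Is bs cs by unfold_locales (fact assms)+
  define ws where "ws = map (\<lambda>I. (dual_weight (weight_of I),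
              map (\<lambda>x. x - int r) (dual_weight (weight_of ({1..n} - I))))) Is"
  let ?f = "det_fun n r bs cs"
  have lws: "length ws = s" by (simp add: ws_def length_Is)
  have ws_nth: "fst (ws ! k) = dual_weight (weight_of (Is ! k))"
    "snd (ws ! k) = map (\<lambda>x. x - int r) (dual_weight (weight_of ({1..n} - Is ! k)))" if "k < s" for k
    using that by (simp_all add: ws_def length_Is)
  have wl: "length (fst (ws ! k)) = r" "length (snd (ws ! k)) = n - r" if "k < s" for k
    using ws_nth[OF that] Subsets_nth[OF Is that] card_complement[OF Subsets_nth(1)[OF Is that]] by simp_all
  \<comment> \<open>All first weights have length r and all second ones n - r, so the sizes of the
    groups do not vary with k.\<close>
  have GLp: "GL_product ws = groups"
  proof -
    have "(gs, hs) \<in> GL_product ws \<longleftrightarrow> (gs, hs) \<in> groups" for gs hs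
    proof -
      have "(gs, hs) \<in> GL_product ws \<longleftrightarrow> length gs = s \<and> (\<forall>k<s. gs ! k \<in> GL (length (fst (ws ! k)))) \<and>
          length hs = s \<and> (\<forall>k<s. hs ! k \<in> GL (length (snd (ws ! k))))"
        by (auto simp: GL_product_def list_all2_conv_all_nth lws case_prod_beta)
      also have "\<dots> \<longleftrightarrow> (gs, hs) \<in> groups"
        using wl by (auto simp: groups_def subset_eq all_set_conv_all_nth)
      finally show ?thesis .
    qed
    thus ?thesis by auto
  qed
  show "?f \<in> BW_tensor (map (\<lambda>I. (dual_weight (weight_of I),
              map (\<lambda>x. x - int r) (dual_weight (weight_of ({1..n} - I))))) Is)"
    unfolding ws_def[symmetric] BW_tensor_def
  proof (intro CollectI conjI ballI)
    let ?J = "(SIGMA k:{..<length ws}. {..<length (fst (ws ! k))} \<times> {..<length (fst (ws ! k))}) <+>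
        (SIGMA k:{..<length ws}. {..<length (snd (ws ! k))} \<times> {..<length (snd (ws ! k))})"
    let ?coord = "\<lambda>(gs, hs). case_sum (\<lambda>(k, ij). gs ! k $$ ij) (\<lambda>(k, ij). hs ! k $$ ij)"
    have J: "finite ?J" by (intro finite_Plus finite_SigmaI finite_cartesian_product) auto
    have "holomorphic_wrt ?J ?coord (GL_product ws) (\<lambda>x. ?f (fst x, snd x))"
    proof (rule det_fun_holomorphic[OF J])
      show "x \<in> GL_product ws \<Longrightarrow> (fst x, snd x) \<in> groups" for x by (simp add: GLp)
      fix k i j assume k: "k < s"
      {
        assume "i < r" "j < r"
        hence "Inl (k, i, j) \<in> ?J" using k lws wl by auto
        from holomorphic_wrt_coord[OF J this, of ?coord]
        show "holomorphic_wrt ?J ?coord (GL_product ws) (\<lambda>x. fst x ! k $$ (i, j))"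
          by (simp add: case_prod_beta)
      }
      {
        assume "i < n - r" "j < n - r"
        hence "Inr (k, i, j) \<in> ?J" using k lws wl by auto
        from holomorphic_wrt_coord[OF J this, of ?coord]
        show "holomorphic_wrt ?J ?coord (GL_product ws) (\<lambda>x. snd x ! k $$ (i, j))"
          by (simp add: case_prod_beta)
      }
    qed
    thus "holomorphic_wrt ?J ?coord (GL_product ws) ?f" by simp
  next
    fix x assume "x \<in> GL_product ws"
    then obtain gs hs where x: "x = (gs, hs)" and gh: "(gs, hs) \<in> groups" by (cases x) (auto simp: GLp)
    have len: "length gs = s" "length hs = s" using gh by (auto simp: groups_def)
    have "(\<lambda>g. ?f (gs[k := g], hs)) \<in> L_BW (fst (ws ! k)) \<and> (\<lambda>h. ?f (gs, hs[k := h])) \<in> L_BW (snd (ws ! k))"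
      if k: "k < s" for k
    proof
      \<comment> \<open>When a single argument varies, its entries are coordinates and those of all
        other arguments are constants, so \<open>det_fun_holomorphic\<close> applies again.\<close>
      have hol_const: "holomorphic_wrt ({..<m} \<times> {..<m}) (\<lambda>g ij. g $$ ij) (GL m) (\<lambda>_. c)" for m c
        by (rule holomorphic_wrt_const) simp
      have hol_coord: "holomorphic_wrt ({..<m} \<times> {..<m}) (\<lambda>g ij. g $$ ij) (GL m) (\<lambda>g. g $$ (i, j))"
        if "i < m" "j < m" for m i j
        by (rule holomorphic_wrt_coord) (use that in auto)
      show "(\<lambda>g. ?f (gs[k := g], hs)) \<in> L_BW (fst (ws ! k))"
        unfolding L_BW_def wl[OF k]
      proof (intro CollectI conjI ballI)
        show "holomorphic_wrt ({..<r} \<times> {..<r}) (\<lambda>g ij. g $$ ij) (GL r) (\<lambda>g. ?f (gs[k := g], hs))"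
        proof (rule det_fun_holomorphic)
          show "g \<in> GL r \<Longrightarrow> (gs[k := g], hs) \<in> groups" for g by (rule groups_update(1)[OF gh])
          show "holomorphic_wrt ({..<r} \<times> {..<r}) (\<lambda>g ij. g $$ ij) (GL r) (\<lambda>g. gs[k := g] ! l $$ (i, j))"
            if "l < s" "i < r" "j < r" for l i j
            using that hol_const hol_coord k len by (cases "l = k") auto
        qed (use hol_const in auto)
        fix g b assume g: "g \<in> GL r" and b: "b \<in> borel_GL r"
        \<comment> \<open>The Borel rule is applied at the tuple already updated by
          \<open>g\<close>; the second update at position \<open>k\<close> overwrites the
          first.\<close>
        show "?f (gs[k := g * b], hs) = ?f (gs[k := g], hs) * borel_char (dual_weight (fst (ws ! k))) b"
          using det_fun_borel_right_g[OF groups_update(1)[OF gh g, of k] k b] k len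
          by (simp add: ws_nth dual_weight_dual_weight)
      qed
      show "(\<lambda>h. ?f (gs, hs[k := h])) \<in> L_BW (snd (ws ! k))"
        unfolding L_BW_def wl[OF k]
      proof (intro CollectI conjI ballI)
        show "holomorphic_wrt ({..<n - r} \<times> {..<n - r}) (\<lambda>g ij. g $$ ij) (GL (n - r)) (\<lambda>h. ?f (gs, hs[k := h]))"
        proof (rule det_fun_holomorphic)
          show "h \<in> GL (n - r) \<Longrightarrow> (gs, hs[k := h]) \<in> groups" for h by (rule groups_update(2)[OF gh])
          show "holomorphic_wrt ({..<n - r} \<times> {..<n - r}) (\<lambda>g ij. g $$ ij) (GL (n - r)) (\<lambda>h. hs[k := h] ! l $$ (i, j))"
            if "l < s" "i < n - r" "j < n - r" for l i j
            using that hol_const hol_coord k len by (cases "l = k") auto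
        qed (use hol_const in auto)
        fix h b assume h: "h \<in> GL (n - r)" and b: "b \<in> borel_GL (n - r)"
        show "?f (gs, hs[k := h * b]) = ?f (gs, hs[k := h]) * borel_char (dual_weight (snd (ws ! k))) b"
          using det_fun_borel_right_h[OF groups_update(2)[OF gh h, of k] k b] k len
          by (simp add: ws_nth dual_weight_shift)
      qed
    qed
    thus "case x of (gs, hs) \<Rightarrow> \<forall>k<length ws.
        (\<lambda>g. ?f (gs[k := g], hs)) \<in> L_BW (fst (ws ! k)) \<and> (\<lambda>h. ?f (gs, hs[k := h])) \<in> L_BW (snd (ws ! k))"
      by (simp add: x lws)
  qed
  show "\<forall>g \<in> GL r. \<forall>g' \<in> GL (n - r). \<forall>gs hs.
            length gs = s \<and> set gs \<subseteq> GL r \<and> length hs = s \<and> set hs \<subseteq> GL (n - r) \<longrightarrow>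
            diag_action g g' ?f (gs, hs) =
              Determinant.det g powi (int (n - r) * (int s - 1)) * Determinant.det g' powi (int r * (1 - int s)) *
              ?f (gs, hs)"
    using det_fun_diag_action by (auto simp: groups_def)
qed

end
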